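(* Let $G$ be a finite simple graph (not necessarily planar) in which no triangle shares an edge with a cycle of length $4$. Let $a,b$ be positive real constants satisfying all of the following inequalities: $2a+b\ge 1$; $3a+4b\ge 2$; $9a+11b\ge 6$; $a+5b\ge 1$; $4a+9b\ge 3$; $10a+16b\ge 7$; $13a+20b\ge 8$; $5a+14b\ge 4$; $a+\tfrac{3}{2}b\ge \tfrac{2}{3}$. Then $\alpha(G) \ge |V(G)| - \bigl(a|V(G)| + b|E(G)| + b\lambda(G)\bigr)$.
   Context: $\alpha(G)$ is the maximum size of an independent set of $G$. A connected component of $G$ is a 2-chain of triangles if it is isomorphic to the graph obtained from two vertex-disjoint triangles by adding one edge between them. A component is difficult if it is a triangle or a 2-chain of triangles, and $\lambda(G)$ denotes the number of difficult components of $G$. *)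

theory Defs
  imports Complex_Main "HOL-Library.Ramsey"
begin

text \<open>
  A graph is given by its vertex set \<open>V\<close> and its set \<open>E\<close> of edges, each edge being
  a two-element subset of \<open>V\<close>. Independence is \<^const>\<open>indep\<close> from the Ramsey theory.
\<close>

definition fin_simple_graph :: "'a set \<Rightarrow> 'a set set \<Rightarrow> bool" where
  "fin_simple_graph V E \<longleftrightarrow> finite V \<and> E \<subseteq> nsets V 2"

definition independence_number :: "'a set \<Rightarrow> 'a set set \<Rightarrow> nat" where
  "independence_number V E = Max (card ` {S. S \<subseteq> V \<and> indep S E})"

text \<open>
  A cycle is given by the list of its vertices in cyclic order; it is a subgraph, not
  necessarily an induced one.
\<close>

definition cycle_edges :: "'a list \<Rightarrow> 'a set set" where
  "cycle_edges xs = {{xs ! i, xs ! (Suc i mod length xs)} | i. i < length xs}"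

definition is_cycle :: "'a set set \<Rightarrow> 'a list \<Rightarrow> bool" where
  "is_cycle E xs \<longleftrightarrow> length xs \<ge> 3 \<and> distinct xs \<and> cycle_edges xs \<subseteq> E"

definition no_triangle_shares_edge_with_C4 :: "'a set set \<Rightarrow> bool" where
  "no_triangle_shares_edge_with_C4 E \<longleftrightarrow>
     (\<forall>xs ys. is_cycle E xs \<and> length xs = 3 \<and> is_cycle E ys \<and> length ys = 4 \<longrightarrow>
        cycle_edges xs \<inter> cycle_edges ys = {})"

definition connected_rel :: "'a set \<Rightarrow> 'a set set \<Rightarrow> ('a \<times> 'a) set" where
  "connected_rel V E = {(u, v). u \<in> V \<and> v \<in> V \<and> (u, v) \<in> {(x, y). {x, y} \<in> E}\<^sup>*}"

text \<open>A component is represented by its vertex set; its edges are \<open>induced_edges E C\<close>.\<close>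

definition components :: "'a set \<Rightarrow> 'a set set \<Rightarrow> 'a set set" where
  "components V E = V // connected_rel V E"

definition induced_edges :: "'a set set \<Rightarrow> 'a set \<Rightarrow> 'a set set" where
  "induced_edges E C = {e \<in> E. e \<subseteq> C}"

definition graph_isomorphic :: "'a set \<Rightarrow> 'a set set \<Rightarrow> 'b set \<Rightarrow> 'b set set \<Rightarrow> bool" where
  "graph_isomorphic V E W F \<longleftrightarrow>
     (\<exists>f. bij_betw f V W \<and> (\<forall>u\<in>V. \<forall>v\<in>V. {u, v} \<in> E \<longleftrightarrow> {f u, f v} \<in> F))"

definition is_triangle :: "'a set \<Rightarrow> 'a set set \<Rightarrow> bool" where
  "is_triangle V E \<longleftrightarrow> graph_isomorphic V E {0, 1, 2 :: nat} {{0, 1}, {1, 2}, {0, 2}}"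

text \<open>The two triangles are 0, 1, 2 and 3, 4, 5; the added edge joins 2 and 3.\<close>

definition is_2_chain_of_triangles :: "'a set \<Rightarrow> 'a set set \<Rightarrow> bool" where
  "is_2_chain_of_triangles V E \<longleftrightarrow>
     graph_isomorphic V E {0, 1, 2, 3, 4, 5 :: nat}
       ({{0, 1}, {1, 2}, {0, 2}} \<union> {{3, 4}, {4, 5}, {3, 5}} \<union> {{2, 3}})"

definition difficult :: "'a set set \<Rightarrow> 'a set \<Rightarrow> bool" where
  "difficult E C \<longleftrightarrow>
     is_triangle C (induced_edges E C) \<or> is_2_chain_of_triangles C (induced_edges E C)"

definition num_difficult :: "'a set \<Rightarrow> 'a set set \<Rightarrow> nat" where
  "num_difficult V E = card {C \<in> components V E. difficult E C}"

end

theory Submission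
  imports Defs
begin

text \<open>
  Write \<open>n\<close>, \<open>m\<close> for the numbers of vertices and edges. The claim is linear in \<open>(a, b)\<close>, so it
  is enough to prove it at the vertices of the polyhedron of admissible \<open>(a, b)\<close>. Two of them are
  trivial, and the other two amount to \<open>8 n \<le> 13 \<alpha> + 3 m + 3 \<lambda>\<close> and \<open>15 n \<le> 34 \<alpha> + 3 m + 3 \<lambda>\<close>. Both
  are proved in the sharper form \<open>r n \<le> q \<alpha> + 3 m + p\<close>, where \<open>q = 3 r - 11\<close> and the penalty \<open>p\<close>
  counts 2 for every component that is a triangle and 1 for every 2-chain.

  Consider a counterexample \<open>W\<close> that is minimal among the induced subgraphs. Deleting a set \<open>X\<close> which
  contains the closed neighbourhood of an independent set \<open>I\<close> shows that the penalty of the new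
  difficult components of \<open>W - X\<close> must be large compared with the number of edges deleted. Since
  such components send several edges to \<open>X\<close>, this excludes difficult components, triangles with
  at most one outgoing edge, and vertices of degree at most 2. Now deleting a single vertex
  creates no difficult component, which finishes the case \<open>r = 8\<close> and leaves only the degrees 3
  and 4 for \<open>r = 15\<close>. There, deleting closed neighbourhoods shows that the neighbours of a vertex
  of degree 3 have degree 3 and that each such vertex is in a triangle; two triangles joined by an
  edge then give a final reduction, and a 4-regular graph is handled by any closed neighbourhood.
\<close>

section \<open>Triangles and 2-chains in induced subgraphs\<close>

text \<open>
  In \<open>house_free\<close> the vertex \<open>u\<close> or \<open>v\<close> of the 4-cycle \<open>x\<close>, \<open>y\<close>, \<open>u\<close>, \<open>v\<close> may coincide with \<open>z\<close>, so two
  triangles sharing an edge are excluded as well.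
\<close>

locale sparse_triangles =
  fixes adj :: "'a \<Rightarrow> 'a \<Rightarrow> bool"
  assumes adj_sym: "adj x y \<Longrightarrow> adj y x"
    and adj_irrefl: "\<not> adj x x"
    and house_free: "\<lbrakk>adj x y; adj y z; adj x z; adj y u; adj u v; adj v x; u \<noteq> x; v \<noteq> y\<rbrakk> \<Longrightarrow> False"
begin

definition nb :: "'a set \<Rightarrow> 'a \<Rightarrow> 'a set" where
  "nb W v = {u \<in> W. adj v u}"

text \<open>This counts ordered adjacent pairs: for disjoint sets it is the number of edges between
  them, and within one set every edge counts twice.\<close>

definition arcs :: "'a set \<Rightarrow> 'a set \<Rightarrow> nat" where
  "arcs X Y = (\<Sum>x\<in>X. card (nb Y x))"

definition tri :: "'a set \<Rightarrow> bool" where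
  "tri T \<longleftrightarrow> (\<exists>x y z. T = {x, y, z} \<and> adj x y \<and> adj y z \<and> adj x z)"

definition chain :: "'a set \<Rightarrow> bool" where
  "chain K \<longleftrightarrow> (\<exists>S T x y. tri S \<and> tri T \<and> S \<inter> T = {} \<and> K = S \<union> T \<and> x \<in> S \<and> y \<in> T \<and> adj x y \<and>
     (\<forall>a\<in>S. \<forall>b\<in>T. adj a b \<longrightarrow> a = x \<and> b = y))"

text \<open>Such a \<open>K\<close> is a union of components of the graph induced on
  \<open>W\<close>. Triangles and 2-chains are connected, so for them it means being a component,
  and no paths are needed.\<close>

definition closed_in :: "'a set \<Rightarrow> 'a set \<Rightarrow> bool" where
  "closed_in W K \<longleftrightarrow> K \<subseteq> W \<and> (\<forall>x\<in>K. nb W x \<subseteq> K)"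

definition tricomps :: "'a set \<Rightarrow> 'a set set" where
  "tricomps W = {K. closed_in W K \<and> tri K}"

definition chaincomps :: "'a set \<Rightarrow> 'a set set" where
  "chaincomps W = {K. closed_in W K \<and> chain K}"

text \<open>
  The weights are exactly the amounts by which a triangle and a 2-chain violate the inequality
  without penalty.
\<close>

definition penalty :: "'a set \<Rightarrow> nat" where
  "penalty W = 2 * card (tricomps W) + card (chaincomps W)"

text \<open>The inequality is doubled because \<open>arcs W W\<close> counts each edge twice.\<close>

definition good :: "nat \<Rightarrow> nat \<Rightarrow> 'a set \<Rightarrow> bool" where
  "good r q W \<longleftrightarrow> (\<exists>S\<subseteq>W. (\<forall>x\<in>S. \<forall>y\<in>S. \<not> adj x y) \<and>
     2 * r * card W \<le> 2 * q * card S + 3 * arcs W W + 2 * penalty W)"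

lemma adj_commute: "adj x y \<longleftrightarrow> adj y x"
  using adj_sym by blast

lemma adj_neq: "adj x y \<Longrightarrow> x \<noteq> y"
  using adj_irrefl by blast

text \<open>The degenerate case of \<open>house_free\<close>: distinct \<open>z\<close> and
  \<open>w\<close> would give the 4-cycle \<open>x\<close>, \<open>z\<close>, \<open>y\<close>,
  \<open>w\<close> through edges of the triangle \<open>x y z\<close>.\<close>

lemma diamond_free:
  assumes "adj x y" "adj x z" "adj y z" "adj x w" "adj y w"
  shows "z = w"
  using house_free[of x z y y w] assms by (metis adj_sym adj_irrefl)

lemma in_nb [simp]: "u \<in> nb W v \<longleftrightarrow> u \<in> W \<and> adj v u"
  by (simp add: nb_def)

lemma nb_subset: "nb W v \<subseteq> W"
  by (auto simp: nb_def)

lemma finite_nb [simp]: "finite W \<Longrightarrow> finite (nb W v)"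
  by (simp add: nb_def)

lemma nb_mono: "X \<subseteq> Y \<Longrightarrow> nb X v \<subseteq> nb Y v"
  by auto

section \<open>Counting edges between vertex sets\<close>

lemma card_nb_Un: "\<lbrakk>finite X; finite Y; X \<inter> Y = {}\<rbrakk> \<Longrightarrow> card (nb (X \<union> Y) v) = card (nb X v) + card (nb Y v)"
  by (subst card_Un_disjoint [symmetric]) (auto simp: nb_def intro!: arg_cong[where f = card])

lemma arcs_sym: "\<lbrakk>finite X; finite Y\<rbrakk> \<Longrightarrow> arcs X Y = arcs Y X"
proof -
  assume fin: "finite X" "finite Y"
  have eq: "card (nb B v) = (\<Sum>y\<in>B. if adj v y then 1 else 0)" if "finite B" for B v
    using that by (simp add: nb_def sum.If_cases Int_def)
  have "arcs X Y = (\<Sum>x\<in>X. \<Sum>y\<in>Y. if adj x y then 1 else 0)"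
    unfolding arcs_def using fin eq by simp
  also have "\<dots> = (\<Sum>y\<in>Y. \<Sum>x\<in>X. if adj y x then 1 else 0)"
    by (subst sum.swap) (simp add: adj_commute)
  also have "\<dots> = arcs Y X"
    unfolding arcs_def using fin eq by simp
  finally show ?thesis .
qed

lemma arcs_Un_left: "\<lbrakk>finite X; finite X'; X \<inter> X' = {}\<rbrakk> \<Longrightarrow> arcs (X \<union> X') Y = arcs X Y + arcs X' Y"
  by (simp add: arcs_def sum.union_disjoint)

lemma arcs_Un_right: "\<lbrakk>finite Y; finite Y'; Y \<inter> Y' = {}\<rbrakk> \<Longrightarrow> arcs X (Y \<union> Y') = arcs X Y + arcs X Y'"
  by (simp add: arcs_def card_nb_Un sum.distrib)

lemma arcs_mono_left: "\<lbrakk>finite X'; X \<subseteq> X'\<rbrakk> \<Longrightarrow> arcs X Y \<le> arcs X' Y"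
  by (auto simp: arcs_def intro!: sum_mono2)

lemma arcs_split:
  assumes "finite W" "X \<subseteq> W"
  shows "arcs W W = arcs X X + 2 * arcs X (W - X) + arcs (W - X) (W - X)"
proof -
  have fin: "finite X" "finite (W - X)" and W: "W = X \<union> (W - X)" "X \<inter> (W - X) = {}"
    using assms finite_subset by auto
  have "arcs (X \<union> (W - X)) (X \<union> (W - X)) =
      arcs X X + arcs X (W - X) + (arcs (W - X) X + arcs (W - X) (W - X))"
    using fin W(2) by (simp only: arcs_Un_left arcs_Un_right)
  then show ?thesis
    using W(1) arcs_sym[OF fin] by simp
qed

lemma sum_degree_split:
  assumes "finite W" "X \<subseteq> W"
  shows "(\<Sum>x\<in>X. card (nb W x)) = arcs X X + arcs X (W - X)"
proof -
  have "arcs X (X \<union> (W - X)) = arcs X X + arcs X (W - X)"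
    using assms finite_subset by (intro arcs_Un_right) auto
  then show ?thesis
    using assms by (simp add: arcs_def Un_absorb1)
qed

lemma even_arcs: "finite X \<Longrightarrow> even (arcs X X)"
proof (induction X rule: finite_induct)
  case empty
  then show ?case by (simp add: arcs_def)
next
  case (insert x X)
  have "arcs {x} {x} = 0"
    by (simp add: arcs_def nb_def adj_irrefl)
  with arcs_split[of "insert x X" "{x}"] insert show ?case
    by simp
qed

section \<open>Structure of triangles and 2-chains\<close>

lemma triE:
  assumes "tri T" "x \<in> T"
  obtains y z where "T = {x, y, z}" "adj x y" "adj y z" "adj x z" "x \<noteq> y" "y \<noteq> z" "x \<noteq> z"
proof -
  obtain a b c where T: "T = {a, b, c}" "adj a b" "adj b c" "adj a c"
    using assms(1) unfolding tri_def by blast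
  have "x = a \<or> x = b \<or> x = c"
    using assms(2) T(1) by blast
  then show ?thesis
  proof (elim disjE)
    assume "x = a"
    then show ?thesis
      using T adj_neq by (intro that[of b c]) auto
  next
    assume "x = b"
    then show ?thesis
      using T adj_neq adj_sym by (intro that[of a c]) auto
  next
    assume "x = c"
    then show ?thesis
      using T adj_neq adj_sym by (intro that[of a b]) auto
  qed
qed

lemma tri_card: "tri T \<Longrightarrow> card T = 3"
  unfolding tri_def by (auto simp: card_insert_if dest: adj_neq)

lemma tri_finite: "tri T \<Longrightarrow> finite T"
  unfolding tri_def by auto

lemma tri_adj: "\<lbrakk>tri T; x \<in> T; y \<in> T; x \<noteq> y\<rbrakk> \<Longrightarrow> adj x y"
  unfolding tri_def by (auto simp: adj_commute)

lemma triI: "\<lbrakk>adj x y; adj y z; adj x z\<rbrakk> \<Longrightarrow> tri {x, y, z}"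
  unfolding tri_def by blast

lemma tri_nb: "tri T \<Longrightarrow> x \<in> T \<Longrightarrow> nb T x = T - {x}"
  using tri_adj[of T x] adj_irrefl by fastforce

lemma tri_arcs: "tri T \<Longrightarrow> arcs T T = 6"
  by (simp add: arcs_def tri_nb tri_card tri_finite card_Diff_singleton)

text \<open>Two neighbours of \<open>u\<close> in \<open>T\<close> would put a second triangle on an
  edge of \<open>T\<close>.\<close>

lemma tri_one_nb:
  assumes "tri T" "u \<notin> T" "x \<in> T" "y \<in> T" "adj u x" "adj u y"
  shows "x = y"
proof (rule ccontr)
  assume "x \<noteq> y"
  obtain z w where T: "T = {x, z, w}" "adj x z" "adj z w" "adj x w"
    using triE[OF assms(1,3)] by metis
  have "u \<noteq> z" "u \<noteq> w" "adj x u" "adj y u" "y = z \<or> y = w"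
    using T(1) assms(2,4-6) adj_sym \<open>x \<noteq> y\<close> by auto
  then show False
    using T(2-4) diamond_free[of x z w u] diamond_free[of x w z u] adj_sym by metis
qed

lemma chain_arcs_between:
  assumes "tri S" "tri T" "x \<in> S" "y \<in> T" "adj x y" "\<forall>a\<in>S. \<forall>b\<in>T. adj a b \<longrightarrow> a = x \<and> b = y"
  shows "arcs S T = 1"
proof -
  have "nb T a = (if a = x then {y} else {})" if "a \<in> S" for a
  proof -
    have "b \<in> nb T a \<longleftrightarrow> a = x \<and> b = y" for b
      unfolding in_nb using assms(4-6) that by metis
    then show ?thesis
      by (simp add: set_eq_iff del: in_nb)
  qed
  then have "card (nb T a) = (if a = x then 1 else 0)" if "a \<in> S" for a
    using that by simp
  then show ?thesis
    using assms(1,3) by (simp add: arcs_def tri_finite)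
qed

lemma chain_card: "chain K \<Longrightarrow> card K = 6"
  unfolding chain_def by (auto simp: card_Un_disjoint tri_card tri_finite)

lemma chain_arcs: "chain K \<Longrightarrow> arcs K K = 14"
proof -
  assume "chain K"
  then obtain S T x y where c: "tri S" "tri T" "S \<inter> T = {}" "K = S \<union> T" "x \<in> S" "y \<in> T" "adj x y"
     "\<forall>a\<in>S. \<forall>b\<in>T. adj a b \<longrightarrow> a = x \<and> b = y" unfolding chain_def by metis
  have "arcs S T = 1" "arcs T S = 1"
    using chain_arcs_between[OF c(1,2,5-8)] arcs_sym[of S T] c(1,2) tri_finite by auto
  then show ?thesis
    using c(1-4) by (simp add: arcs_Un_left arcs_Un_right tri_finite tri_arcs)
qed

lemma tri_not_chain: "tri K \<Longrightarrow> \<not> chain K"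
  using tri_card chain_card by fastforce

text \<open>Connectedness of a triangle, stated through sets closed under neighbours;
  \<open>chain_linked\<close> does the same for 2-chains.\<close>

lemma tri_linked:
  assumes "tri T" "x \<in> T" "x \<in> C" "\<forall>x\<in>C \<inter> T. nb T x \<subseteq> C"
  shows "T \<subseteq> C"
  using assms tri_nb[of T x] by auto

lemma chain_linked:
  assumes "chain K" "x \<in> K" "x \<in> C" "\<forall>x\<in>C \<inter> K. nb K x \<subseteq> C"
  shows "K \<subseteq> C"
proof -
  obtain S T u v where c: "tri S" "tri T" "K = S \<union> T" "u \<in> S" "v \<in> T" "adj u v"
    using assms(1) unfolding chain_def by metis
  have S: "S \<subseteq> C" if "s \<in> S" "s \<in> C" for s
    by (rule tri_linked[OF c(1) that]) (use assms(4) c(3) nb_mono[of S K] in blast)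
  have T: "T \<subseteq> C" if "s \<in> T" "s \<in> C" for s
    by (rule tri_linked[OF c(2) that]) (use assms(4) c(3) nb_mono[of T K] in blast)
  have uv: "v \<in> C" if "u \<in> C"
    using that assms(4) c by (meson IntI UnI1 UnI2 in_nb subsetD)
  have vu: "u \<in> C" if "v \<in> C"
    using that assms(4) c adj_sym by (meson IntI UnI1 UnI2 in_nb subsetD)
  show ?thesis
    using assms(2,3) S T uv vu c(3-5) by blast
qed

section \<open>Difficult components of an induced subgraph\<close>

lemma dcomp_linked:
  assumes "K \<in> tricomps W \<union> chaincomps W" "x \<in> K" "x \<in> C" "\<forall>x\<in>C. nb W x \<subseteq> C"
  shows "K \<subseteq> C"
proof -
  have "K \<subseteq> W"
    using assms(1) by (auto simp: tricomps_def chaincomps_def closed_in_def)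
  then have "\<forall>x\<in>C \<inter> K. nb K x \<subseteq> C"
    using assms(4) nb_mono[of K W] by blast
  with assms(1-3) show ?thesis
    using tri_linked[of K x C] chain_linked[of K x C] by (auto simp: tricomps_def chaincomps_def)
qed

lemma dcomp_closed:
  assumes "K \<in> tricomps W \<union> chaincomps W"
  shows "K \<subseteq> W" "\<And>x. x \<in> K \<Longrightarrow> nb W x \<subseteq> K"
  using assms by (auto simp: tricomps_def chaincomps_def closed_in_def)

lemma dcomp_nonempty: "K \<in> tricomps W \<union> chaincomps W \<Longrightarrow> K \<noteq> {}"
  using tri_card chain_card by (fastforce simp: tricomps_def chaincomps_def)

lemma dcomps_disjoint:
  assumes "K \<in> tricomps W \<union> chaincomps W" "L \<in> tricomps W \<union> chaincomps W" "K \<noteq> L"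
  shows "K \<inter> L = {}"
proof (rule ccontr)
  assume "K \<inter> L \<noteq> {}"
  then obtain x where "x \<in> K" "x \<in> L" by blast
  then have "K \<subseteq> L" "L \<subseteq> K"
    using dcomp_linked[OF assms(1), of x L] dcomp_linked[OF assms(2), of x K]
      dcomp_closed(2)[OF assms(1)] dcomp_closed(2)[OF assms(2)] by blast+
  with assms(3) show False by blast
qed

lemma finite_dcomps:
  assumes "finite W"
  shows "finite (tricomps W)" "finite (chaincomps W)"
  using assms dcomp_closed(1) by (auto intro!: finite_subset[of _ "Pow W"])

lemma tricomps_chaincomps_disjoint: "tricomps W \<inter> chaincomps W = {}"
  using tri_not_chain by (auto simp: tricomps_def chaincomps_def)

text \<open>Difficult components of \<open>W - X\<close> are pairwise disjoint, so the edges they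
  send to \<open>X\<close> are different edges leaving \<open>X\<close>.\<close>

lemma cut_bound:
  assumes "finite W" "X \<subseteq> W"
    and tri: "\<And>K. K \<in> tricomps (W - X) \<Longrightarrow> c \<le> arcs K X"
    and chain: "\<And>K. K \<in> chaincomps (W - X) \<Longrightarrow> d \<le> arcs K X"
  shows "c * card (tricomps (W - X)) + d * card (chaincomps (W - X)) \<le> arcs X (W - X)"
proof -
  let ?t = "tricomps (W - X)" and ?c = "chaincomps (W - X)"
  have fin: "finite ?t" "finite ?c" "finite X" "finite (W - X)"
    using assms finite_dcomps finite_subset by auto
  have sub: "K \<subseteq> W - X" if "K \<in> ?t \<union> ?c" for K
    using that dcomp_closed(1) by blast
  have "c * card ?t + d * card ?c \<le> (\<Sum>K\<in>?t. arcs K X) + (\<Sum>K\<in>?c. arcs K X)"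
    using sum_mono[of ?t "\<lambda>_. c" "\<lambda>K. arcs K X"] sum_mono[of ?c "\<lambda>_. d" "\<lambda>K. arcs K X"] tri chain
    by (intro add_mono) (auto simp: mult.commute)
  also have "\<dots> = (\<Sum>K\<in>?t \<union> ?c. arcs K X)"
    using fin tricomps_chaincomps_disjoint by (simp add: sum.union_disjoint)
  also have "\<dots> = arcs (\<Union>(?t \<union> ?c)) X"
    unfolding arcs_def using sub fin(4) dcomps_disjoint
    by (subst sum.Union_disjoint) (auto intro: finite_subset)
  also have "\<dots> \<le> arcs (W - X) X"
    using sub fin by (intro arcs_mono_left) auto
  finally show ?thesis
    using arcs_sym[OF fin(3,4)] by simp
qed

lemma dcomp_extend:
  assumes "K \<in> tricomps (W - X) \<union> chaincomps (W - X)" "arcs K X = 0" "finite W" "X \<subseteq> W"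
  shows "closed_in W K"
proof -
  have K: "K \<subseteq> W - X" "\<And>x. x \<in> K \<Longrightarrow> nb (W - X) x \<subseteq> K"
    using dcomp_closed[OF assms(1)] by auto
  have "finite K" "finite X"
    using K(1) assms(3,4) finite_subset by blast+
  then have "nb X x = {}" if "x \<in> K" for x
    using assms(2) that unfolding arcs_def by (metis card_0_eq finite_nb sum_eq_0_iff)
  then have "nb W x \<subseteq> K" if "x \<in> K" for x
    using K(2)[OF that] that by (auto simp: set_eq_iff subset_iff)
  with K(1) show ?thesis
    by (auto simp: closed_in_def)
qed

lemma arcs_eq_card_Sigma: "\<lbrakk>finite X; finite Y\<rbrakk> \<Longrightarrow> arcs X Y = card (Sigma X (nb Y))"
  by (simp add: arcs_def)

lemma arcs_eq_0:
  assumes "finite X" "finite Y" "arcs X Y = 0" "x \<in> X" "y \<in> Y"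
  shows "\<not> adj x y"
proof -
  have "nb Y x = {}"
    using assms(1-4) by (simp add: arcs_def)
  then have "y \<notin> nb Y x"
    by (metis empty_iff)
  then show ?thesis
    using assms(5) by simp
qed

lemma arcs_neq_0E:
  assumes "arcs X Y \<noteq> 0"
  obtains x y where "x \<in> X" "y \<in> Y" "adj x y"
  using assms unfolding arcs_def nb_def
  by (metis (no_types, lifting) card.empty empty_Collect_eq sum.neutral)

lemma arcs_eq_1:
  assumes "finite X" "finite Y" "arcs X Y = 1"
  obtains x y where "x \<in> X" "y \<in> Y" "adj x y" "\<forall>a\<in>X. \<forall>b\<in>Y. adj a b \<longrightarrow> a = x \<and> b = y"
proof -
  obtain e where "Sigma X (nb Y) = {e}"
    using assms by (metis arcs_eq_card_Sigma card_1_singletonE)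
  moreover obtain x y where "e = (x, y)"
    by fastforce
  ultimately have *: "\<And>a b. (a \<in> X \<and> b \<in> Y \<and> adj a b) \<longleftrightarrow> a = x \<and> b = y"
    by (auto simp: nb_def set_eq_iff)
  show ?thesis
    by (rule that[of x y]) (use * in blast)+
qed

text \<open>By \<open>tri_one_nb\<close> the neighbourhoods in \<open>X\<close> of the three
  vertices are disjoint, so edges can be counted by their ends in \<open>X\<close>.\<close>

lemma arcs_tri:
  assumes "tri T" "T \<inter> X = {}" "finite X"
  shows "arcs T X = card (\<Union>k\<in>T. nb X k)"
proof -
  have "nb X k \<inter> nb X l = {}" if "k \<in> T" "l \<in> T" "k \<noteq> l" for k l
    using tri_one_nb[OF assms(1), of _ k l] that assms(2) adj_sym unfolding nb_def by blast
  then show ?thesis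
    unfolding arcs_def using assms tri_finite by (subst card_UN_disjoint) auto
qed

lemma arcs_tri_le:
  assumes "tri T" "T \<inter> X = {}" "finite X" "B \<subseteq> X" "\<And>k. k \<in> T \<Longrightarrow> nb X k \<subseteq> B"
  shows "arcs T X \<le> card B"
proof -
  have "finite B" "(\<Union>k\<in>T. nb X k) \<subseteq> B"
    using assms finite_subset by auto
  then show ?thesis
    using arcs_tri[OF assms(1-3)] by (simp add: card_mono)
qed

lemma closed_in_cut:
  assumes "closed_in (W - X) K" "X \<subseteq> W"
  shows "arcs K (W - K) = arcs K X"
proof -
  have "nb (W - K) k = nb X k" if "k \<in> K" for k
    using that assms unfolding closed_in_def nb_def by blast
  then show ?thesis
    by (simp add: arcs_def)
qed

lemma card_nb_tri_le:
  assumes "tri T" "k \<in> T" "finite X" "nb W k \<subseteq> nb X k \<union> (T - {k})"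
  shows "card (nb W k) \<le> card (nb X k) + 2"
proof -
  have "card (nb W k) \<le> card (nb X k \<union> (T - {k}))"
    using assms tri_finite by (intro card_mono) auto
  also have "\<dots> \<le> card (nb X k) + 2"
    using card_Un_le[of "nb X k" "T - {k}"] assms(1,2) by (simp add: tri_card tri_finite)
  finally show ?thesis .
qed

lemma tricomp_degree:
  assumes "K \<in> tricomps (W - X)" "finite X" "k \<in> K"
  shows "card (nb W k) \<le> card (nb X k) + 2"
proof (rule card_nb_tri_le)
  show "nb W k \<subseteq> nb X k \<union> (K - {k})"
    using assms adj_irrefl unfolding tricomps_def closed_in_def nb_def by blast
qed (use assms in \<open>auto simp: tricomps_def\<close>)

text \<open>Inside the 2-chain a vertex has two neighbours, and a bridge end has three; all its
  other neighbours in \<open>W\<close> are in \<open>X\<close>.\<close>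

lemma chaincomp_halves:
  assumes "K \<in> chaincomps (W - X)" "finite X"
  obtains S T u v where "tri S" "tri T" "S \<inter> T = {}" "K = S \<union> T" "u \<in> S" "v \<in> T"
    "\<And>k. k \<in> S - {u} \<Longrightarrow> card (nb W k) \<le> card (nb X k) + 2"
    "\<And>k. k \<in> T - {v} \<Longrightarrow> card (nb W k) \<le> card (nb X k) + 2"
    "card (nb W u) \<le> card (nb X u) + 3"
proof -
  have cl: "closed_in (W - X) K" and "chain K"
    using assms(1) by (auto simp: chaincomps_def)
  then obtain S T u v where c: "tri S" "tri T" "S \<inter> T = {}" "K = S \<union> T" "u \<in> S" "v \<in> T"
    and e: "\<And>a b. a \<in> S \<Longrightarrow> b \<in> T \<Longrightarrow> adj a b \<Longrightarrow> a = u \<and> b = v"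
    unfolding chain_def by metis
  have nbK: "nb W k \<subseteq> nb X k \<union> (K - {k})" if "k \<in> K" for k
    using that cl adj_irrefl unfolding closed_in_def nb_def by blast
  show ?thesis
  proof (rule that[OF c])
    show "card (nb W k) \<le> card (nb X k) + 2" if "k \<in> S - {u}" for k
      using nbK[of k] that c(4) e[of k]
      by (intro card_nb_tri_le[OF c(1) _ assms(2)]) (auto simp: nb_def subset_iff)
    show "card (nb W k) \<le> card (nb X k) + 2" if "k \<in> T - {v}" for k
      using nbK[of k] that c(4) e[of _ k] adj_sym[of k]
      by (intro card_nb_tri_le[OF c(2) _ assms(2)]) (auto simp: nb_def subset_iff)
    have "nb W u \<subseteq> nb X u \<union> insert v (S - {u})"
      using nbK[of u] c(4,5) e[of u] unfolding nb_def by blast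
    then have "card (nb W u) \<le> card (nb X u \<union> insert v (S - {u}))"
      using assms(2) tri_finite[OF c(1)] by (intro card_mono) auto
    also have "\<dots> \<le> card (nb X u) + card (insert v (S - {u}))"
      by (rule card_Un_le)
    also have "card (insert v (S - {u})) \<le> 3"
      using c(1,5) card_insert_le_m1[of 3 "S - {u}" v] by (simp add: tri_card tri_finite)
    finally show "card (nb W u) \<le> card (nb X u) + 3"
      by simp
  qed
qed

text \<open>The only edge of a difficult component leaving a triangle in it is the bridge of a 2-chain.\<close>

lemma dcomp_tri:
  assumes "K \<in> tricomps (W - X) \<union> chaincomps (W - X)" "finite X"
  obtains T where "tri T" "T \<subseteq> K" "(\<Sum>k\<in>T. card (nb W k)) \<le> arcs T X + 7"
proof (cases "K \<in> tricomps (W - X)")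
  case True
  then have "tri K" by (simp add: tricomps_def)
  have "(\<Sum>k\<in>K. card (nb W k)) \<le> (\<Sum>k\<in>K. card (nb X k) + 2)"
    by (intro sum_mono tricomp_degree[OF True assms(2)])
  also have "\<dots> = arcs K X + 6"
    using tri_card[OF \<open>tri K\<close>] by (subst sum.distrib) (simp add: arcs_def)
  finally show ?thesis
    using that[OF \<open>tri K\<close>] by simp
next
  case False
  with assms obtain S u where S: "tri S" "S \<subseteq> K" "u \<in> S"
    "\<And>k. k \<in> S - {u} \<Longrightarrow> card (nb W k) \<le> card (nb X k) + 2"
    "card (nb W u) \<le> card (nb X u) + 3"
    using chaincomp_halves[of K W X] by blast
  have "(\<Sum>k\<in>S - {u}. card (nb W k)) \<le> (\<Sum>k\<in>S - {u}. card (nb X k) + 2)"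
    by (intro sum_mono S(4))
  also have "\<dots> = (\<Sum>k\<in>S - {u}. card (nb X k)) + 4"
    using tri_card[OF S(1)] S(3) tri_finite[OF S(1)] by (subst sum.distrib) simp
  finally show ?thesis
    using that[OF S(1,2)] S(3,5) tri_finite[OF S(1)] by (simp add: arcs_def sum.remove[of S u])
qed

end

section \<open>Minimal counterexamples\<close>

text \<open>
  The relation between \<open>q\<close> and \<open>r\<close> expresses that triangles, 2-chains and trees of three triangles
  attain equality.
\<close>

locale minimal_bad = sparse_triangles adj for adj :: "'a \<Rightarrow> 'a \<Rightarrow> bool" +
  fixes W :: "'a set" and r q :: nat
  assumes finite_W: "finite W"
    and q: "q + 11 = 3 * r" and r: "8 \<le> r"
    and smaller_good: "Y \<subset> W \<Longrightarrow> good r q Y"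
    and not_good: "\<not> good r q W"
begin

text \<open>An independent set of \<open>W - X\<close> stays independent when \<open>I\<close> is
  added, since all neighbours of \<open>I\<close> are deleted. If \<open>ineq\<close> holds, the
  bound for \<open>W - X\<close> carries over to \<open>W\<close>.\<close>

lemma reduce_penalty:
  assumes X: "X \<subseteq> W" "X \<noteq> {}" and I: "I \<subseteq> X" "\<And>x y. x \<in> I \<Longrightarrow> y \<in> I \<Longrightarrow> \<not> adj x y"
    "\<And>x. x \<in> I \<Longrightarrow> nb W x \<subseteq> X"
    and ineq: "2 * r * card X + 2 * penalty (W - X) \<le>
      2 * q * card I + 3 * (arcs X X + 2 * arcs X (W - X)) + 2 * penalty W"
  shows False
proof -
  have "good r q (W - X)"
    using smaller_good X by blast
  then obtain S where S: "S \<subseteq> W - X" "\<And>x y. x \<in> S \<Longrightarrow> y \<in> S \<Longrightarrow> \<not> adj x y"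
    "2 * r * card (W - X) \<le> 2 * q * card S + 3 * arcs (W - X) (W - X) + 2 * penalty (W - X)"
    unfolding good_def by blast
  have fin: "finite X" "finite I" "finite S"
    using finite_W X(1) I(1) S(1) by (auto intro: finite_subset)
  have "card W = card X + card (W - X)"
    using X(1) finite_W fin(1) by (simp add: card_Diff_subset card_mono)
  moreover have "card (S \<union> I) = card S + card I"
    using S(1) I(1) fin by (intro card_Un_disjoint) auto
  ultimately have "2 * r * card W \<le> 2 * q * card (S \<union> I) + 3 * arcs W W + 2 * penalty W"
    using S(3) ineq arcs_split[OF finite_W X(1)] by (simp add: algebra_simps)
  moreover have cross: "\<not> adj x y" if "x \<in> I" "y \<in> S" for x y
    using that S(1) I(3)[of x] by (auto simp: nb_def)
  have "\<not> adj x y" if "x \<in> S \<union> I" "y \<in> S \<union> I" for x y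
    using that S(2) I(2) cross adj_sym by blast
  moreover have "S \<union> I \<subseteq> W"
    using S(1) I(1) X(1) by blast
  ultimately have "good r q W"
    unfolding good_def by blast
  with not_good show False by contradiction
qed

text \<open>Deleting a union of components leaves the other components unchanged, so deleting a
  difficult component creates no new one.\<close>

lemma dcomp_Diff:
  assumes "closed_in W K" "closed_in (W - K) L"
  shows "closed_in W L"
proof -
  have "nb W x \<subseteq> L" if "x \<in> L" for x
  proof
    fix y assume y: "y \<in> nb W x"
    have "x \<in> W" "x \<notin> K"
      using assms(2) that by (auto simp: closed_in_def)
    then have "y \<notin> K"
      using assms(1) y adj_sym[of x y] by (auto simp: closed_in_def nb_def)
    then show "y \<in> L"
      using assms(2) that y by (auto simp: closed_in_def nb_def)
  qed
  then show ?thesis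
    using assms(2) by (auto simp: closed_in_def)
qed

lemma no_tricomps: "tricomps W = {}"
proof (rule ccontr)
  assume "tricomps W \<noteq> {}"
  then obtain K where K: "K \<in> tricomps W" by blast
  then have cl: "closed_in W K" and "tri K"
    by (auto simp: tricomps_def)
  then obtain x y z where xyz: "K = {x, y, z}" "adj x y" "adj y z" "adj x z"
    unfolding tri_def by blast
  have KW: "K \<subseteq> W" using cl closed_in_def by blast
  have "tricomps (W - K) \<subseteq> tricomps W - {K}" "chaincomps (W - K) \<subseteq> chaincomps W"
    using dcomp_Diff[OF cl] xyz(1) by (auto simp: tricomps_def chaincomps_def closed_in_def[of "W - _"])
  then have "card (tricomps (W - K)) \<le> card (tricomps W) - 1" "card (chaincomps (W - K)) \<le> card (chaincomps W)"
    using finite_dcomps[OF finite_W] card_mono K by (metis card_Diff_singleton finite_Diff, metis card_mono)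
  moreover have "card (tricomps W) > 0"
    using finite_dcomps[OF finite_W] K by (auto simp: card_gt_0_iff)
  ultimately have pen: "penalty (W - K) + 2 \<le> penalty W"
    unfolding penalty_def by linarith
  \<comment> \<open>The penalty drops by 2, and \<open>q + 11 = 3 * r\<close> makes the reduction an
    equality.\<close>
  show False
  proof (rule reduce_penalty[of K "{x}"])
    show "2 * r * card K + 2 * penalty (W - K) \<le>
      2 * q * card {x} + 3 * (arcs K K + 2 * arcs K (W - K)) + 2 * penalty W"
      using q pen tri_card[OF \<open>tri K\<close>] tri_arcs[OF \<open>tri K\<close>] by simp
    show "nb W u \<subseteq> K" if "u \<in> {x}" for u
      using cl that xyz(1) by (auto simp: closed_in_def)
  qed (use KW xyz adj_irrefl in auto)
qed

lemma no_chaincomps: "chaincomps W = {}"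
proof (rule ccontr)
  assume "chaincomps W \<noteq> {}"
  then obtain K where K: "K \<in> chaincomps W" by blast
  then have cl: "closed_in W K" and ch: "chain K"
    by (auto simp: chaincomps_def)
  then obtain S T u v where c: "tri S" "tri T" "S \<inter> T = {}" "K = S \<union> T" "u \<in> S" "v \<in> T"
    and e: "\<And>a b. a \<in> S \<Longrightarrow> b \<in> T \<Longrightarrow> adj a b \<Longrightarrow> a = u \<and> b = v"
    unfolding chain_def by metis
  obtain x where x: "x \<in> S" "x \<noteq> u"
    using triE[OF c(1,5)] by (metis insertCI)
  have xv: "x \<noteq> v" "\<not> adj x v" "\<not> adj v x"
    using x c e adj_sym by blast+
  have KW: "K \<subseteq> W" using cl closed_in_def by blast
  have "K \<noteq> {}" using c(4,5) by blast
  then have "chaincomps (W - K) \<subseteq> chaincomps W - {K}" "tricomps (W - K) \<subseteq> tricomps W"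
    using dcomp_Diff[OF cl] by (auto simp: tricomps_def chaincomps_def closed_in_def[of "W - _"])
  then have "card (chaincomps (W - K)) \<le> card (chaincomps W) - 1" "card (tricomps (W - K)) \<le> card (tricomps W)"
    using finite_dcomps[OF finite_W] card_mono K by (metis card_Diff_singleton finite_Diff, metis card_mono)
  moreover have "card (chaincomps W) > 0"
    using finite_dcomps[OF finite_W] K by (auto simp: card_gt_0_iff)
  ultimately have pen: "penalty (W - K) + 1 \<le> penalty W"
    unfolding penalty_def by linarith
  \<comment> \<open>One vertex comes from each triangle: \<open>x\<close> is not a bridge end,
    \<open>v\<close> is. The penalty drops by 1, and the reduction is again an equality.\<close>
  show False
  proof (rule reduce_penalty[of K "{x, v}"])
    show "2 * r * card K + 2 * penalty (W - K) \<le>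
      2 * q * card {x, v} + 3 * (arcs K K + 2 * arcs K (W - K)) + 2 * penalty W"
      using q pen chain_card[OF ch] chain_arcs[OF ch] xv(1) by simp
    show "nb W w \<subseteq> K" if "w \<in> {x, v}" for w
      using cl that x c by (auto simp: closed_in_def)
  qed (use KW x c xv adj_irrefl in auto)
qed

lemma reduce:
  assumes "X \<subseteq> W" "X \<noteq> {}" "I \<subseteq> X" "\<And>x y. x \<in> I \<Longrightarrow> y \<in> I \<Longrightarrow> \<not> adj x y"
    "\<And>x. x \<in> I \<Longrightarrow> nb W x \<subseteq> X"
    and "2 * r * card X + 2 * penalty (W - X) \<le> 2 * q * card I + 3 * (arcs X X + 2 * arcs X (W - X))"
  shows False
  using reduce_penalty[OF assms(1-5)] assms(6) by simp

lemma dcomp_cut_pos: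
  assumes "X \<subseteq> W" "K \<in> tricomps (W - X) \<union> chaincomps (W - X)"
  shows "1 \<le> arcs K X"
proof (rule ccontr)
  assume "\<not> 1 \<le> arcs K X"
  then have "closed_in W K"
    using dcomp_extend[OF assms(2) _ finite_W assms(1)] by simp
  then have "K \<in> tricomps W \<union> chaincomps W"
    using assms(2) by (auto simp: tricomps_def chaincomps_def)
  then show False
    using no_tricomps no_chaincomps by simp
qed

lemma degree_ge_2:
  assumes "v \<in> W"
  shows "2 \<le> card (nb W v)"
proof (rule ccontr)
  assume "\<not> ?thesis"
  then consider "card (nb W v) = 0" | "card (nb W v) = 1" by linarith
  then show False
  proof cases
    case 1
    let ?X = "{v}"
    have cut: "card (tricomps (W - ?X)) + card (chaincomps (W - ?X)) \<le> arcs ?X (W - ?X)"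
      using cut_bound[OF finite_W, of ?X 1 1] dcomp_cut_pos[of ?X] assms by simp
    moreover have "arcs ?X ?X + arcs ?X (W - ?X) = 0"
      using sum_degree_split[OF finite_W, of ?X] 1 assms by simp
    ultimately have "penalty (W - ?X) = 0"
      unfolding penalty_def by simp
    then show False
      using q r 1 assms finite_W by (intro reduce[of ?X ?X]) (auto simp: adj_irrefl)
  next
    case 2
    then obtain u where u: "nb W v = {u}"
      by (auto simp: card_1_singleton_iff)
    then have uv: "u \<in> W" "adj v u" "adj u v" "u \<noteq> v"
      using adj_sym[of v u] adj_neq[of v u] insertI1[of u "{}"] unfolding u[symmetric] in_nb by auto
    let ?X = "{v, u}"
    have X: "?X \<subseteq> W" using assms uv by simp
    have cut: "card (tricomps (W - ?X)) + card (chaincomps (W - ?X)) \<le> arcs ?X (W - ?X)"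
      using cut_bound[OF finite_W X, of 1 1] dcomp_cut_pos[OF X] by simp
    have "nb ?X v = {u}" "nb ?X u = {v}"
      using uv adj_irrefl by auto
    then have "arcs ?X ?X = 2"
      using uv by (simp add: arcs_def)
    \<comment> \<open>The edges leaving \<open>?X\<close> outweigh the new penalty; what remains is
      \<open>4 * r \<le> 2 * q + 6\<close>, which is \<open>8 \<le> r\<close>.\<close>
    then show False
      using q r X u uv cut by (intro reduce[of ?X "{v}"]) (auto simp: penalty_def adj_irrefl)
  qed
qed

text \<open>
  If one edge leaves \<open>T\<close>, delete \<open>T\<close>: a triangle component of the rest would form a 2-chain with \<open>T\<close>,
  so the new penalty is at most 1.
\<close>

lemma triangle_cut_ge_2:
  assumes "tri T" "T \<subseteq> W"
  shows "2 \<le> arcs T (W - T)"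
proof (rule ccontr)
  assume "\<not> ?thesis"
  then have le: "arcs T (W - T) \<le> 1" by simp
  have fin: "finite T" "finite (W - T)"
    using assms tri_finite finite_W by auto
  \<comment> \<open>If every vertex of \<open>T\<close> had a neighbour outside, three edges would
    leave \<open>T\<close>.\<close>
  obtain v where v: "v \<in> T" "nb (W - T) v = {}"
  proof (rule ccontr)
    assume "\<not> thesis"
    then have "1 \<le> card (nb (W - T) x)" if "x \<in> T" for x
      using that \<open>\<And>v. \<lbrakk>v \<in> T; nb (W - T) v = {}\<rbrakk> \<Longrightarrow> thesis\<close> fin(2)
      by (metis One_nat_def Suc_leI card_gt_0_iff finite_nb)
    then have "(\<Sum>x\<in>T. 1) \<le> arcs T (W - T)"
      unfolding arcs_def by (rule sum_mono)
    with le tri_card[OF assms(1)] show False by simp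
  qed
  have cut: "card (tricomps (W - T)) + card (chaincomps (W - T)) \<le> arcs T (W - T)"
    using cut_bound[OF finite_W assms(2), of 1 1] dcomp_cut_pos[OF assms(2)] by simp
  have "tricomps (W - T) = {}"
  proof (rule ccontr)
    assume "tricomps (W - T) \<noteq> {}"
    then obtain K where K: "K \<in> tricomps (W - T)" by blast
    then have cl: "closed_in (W - T) K" and "tri K"
      by (auto simp: tricomps_def)
    have KW: "K \<subseteq> W - T" and finK: "finite K"
      using cl tri_finite[OF \<open>tri K\<close>] by (auto simp: closed_in_def)
    have "arcs T K \<ge> 1"
      using dcomp_cut_pos[OF assms(2)] K arcs_sym[OF fin(1) finK] by simp
    moreover have "arcs T (W - T) = arcs T K + arcs T (W - T - K)"
      using arcs_Un_right[of K "W - T - K" T] KW finK fin by (simp add: Un_absorb1)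
    ultimately have one: "arcs T K = 1" and zero: "arcs T (W - T - K) = 0"
      using le by auto
    obtain x y where "x \<in> T" "y \<in> K" "adj x y" "\<forall>a\<in>T. \<forall>b\<in>K. adj a b \<longrightarrow> a = x \<and> b = y"
      using arcs_eq_1[OF fin(1) finK one] .
    moreover have "T \<inter> K = {}"
      using KW by blast
    ultimately have "chain (T \<union> K)"
      unfolding chain_def using assms(1) \<open>tri K\<close> by blast
    moreover have "closed_in W (T \<union> K)"
    proof -
      have "y \<in> T \<union> K" if "x \<in> T" "y \<in> W" "adj x y" for x y
        using arcs_eq_0[OF fin(1) _ zero, of x y] fin that by blast
      then show ?thesis
        using cl assms(2) unfolding closed_in_def nb_def by blast
    qed
    ultimately show False
      using no_chaincomps by (auto simp: chaincomps_def)
  qed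
  then have "penalty (W - T) \<le> 1" "arcs T (W - T) \<ge> penalty (W - T)"
    using cut le by (auto simp: penalty_def)
  moreover have "arcs T (W - T) \<noteq> 0"
  proof
    assume "arcs T (W - T) = 0"
    then have "closed_in W T"
      using arcs_eq_0[OF fin] assms(2) unfolding closed_in_def nb_def by blast
    then show False
      using no_tricomps assms(1) by (auto simp: tricomps_def)
  qed
  \<comment> \<open>With exactly one leaving edge and penalty 1 both sides of the reduction are
    equal.\<close>
  ultimately show False
    using q v assms by (intro reduce[of T "{v}"]) (auto simp: tri_card tri_arcs adj_irrefl nb_def)
qed

text \<open>If \<open>v\<close> had degree 2, \<open>T\<close> could be deleted with
  \<open>I = {v}\<close>: new triangle components send two edges to \<open>T\<close> by
  \<open>triangle_cut_ge_2\<close>, so the new penalty is at most the number of edges leaving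
  \<open>T\<close>.\<close>

lemma triangle_degree:
  assumes "tri T" "T \<subseteq> W" "v \<in> T"
  shows "3 \<le> card (nb W v)"
proof (rule ccontr)
  assume "\<not> ?thesis"
  then have "card (nb W v) \<le> card (nb T v)"
    using assms by (simp add: tri_nb tri_card tri_finite)
  then have nbv: "nb W v = nb T v"
    using nb_mono[OF assms(2)] finite_W card_seteq finite_nb by metis
  have tri: "2 \<le> arcs K T" if "K \<in> tricomps (W - T)" for K
  proof -
    have "tri K" "closed_in (W - T) K"
      using that by (auto simp: tricomps_def)
    then show ?thesis
      using triangle_cut_ge_2[of K] closed_in_cut[of W T K] assms(2) by (auto simp: closed_in_def)
  qed
  have "2 * card (tricomps (W - T)) + 1 * card (chaincomps (W - T)) \<le> arcs T (W - T)"
    using cut_bound[OF finite_W assms(2), of 2 1] dcomp_cut_pos[OF assms(2)] tri by simp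
  then have "penalty (W - T) \<le> arcs T (W - T)"
    by (simp add: penalty_def)
  moreover have "2 \<le> arcs T (W - T)"
    using triangle_cut_ge_2 assms by simp
  ultimately show False
    using q nbv assms nb_subset by (intro reduce[of T "{v}"]) (auto simp: tri_card tri_arcs adj_irrefl)
qed

text \<open>By \<open>triangle_degree\<close>, each vertex of a triangle component, and each of the
  four vertices of a 2-chain that are not bridge ends, has a neighbour in \<open>X\<close>.\<close>

lemma cut_ge:
  assumes X: "X \<subseteq> W"
  shows "3 * card (tricomps (W - X)) + 4 * card (chaincomps (W - X)) \<le> arcs X (W - X)"
proof (rule cut_bound[OF finite_W X])
  have finX: "finite X"
    using X finite_W finite_subset by blast
  show "3 \<le> arcs K X" if K: "K \<in> tricomps (W - X)" for K
  proof -
    have T: "tri K" "K \<subseteq> W"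
      using K by (auto simp: tricomps_def closed_in_def)
    have "1 \<le> card (nb X k)" if "k \<in> K" for k
      using tricomp_degree[OF K finX that] triangle_degree[OF T that] by simp
    then have "(\<Sum>k\<in>K. 1) \<le> arcs K X"
      unfolding arcs_def by (rule sum_mono)
    then show ?thesis
      using tri_card[OF T(1)] by simp
  qed
  show "4 \<le> arcs K X" if K: "K \<in> chaincomps (W - X)" for K
  proof -
    obtain S T u v where c: "tri S" "tri T" "S \<inter> T = {}" "K = S \<union> T" "u \<in> S" "v \<in> T"
      "\<And>k. k \<in> S - {u} \<Longrightarrow> card (nb W k) \<le> card (nb X k) + 2"
      "\<And>k. k \<in> T - {v} \<Longrightarrow> card (nb W k) \<le> card (nb X k) + 2"
      using chaincomp_halves[OF K finX] by metis
    have "K \<subseteq> W"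
      using K by (auto simp: chaincomps_def closed_in_def)
    have half: "2 \<le> arcs R X" if "tri R" "R \<subseteq> W" "w \<in> R"
      "\<And>k. k \<in> R - {w} \<Longrightarrow> card (nb W k) \<le> card (nb X k) + 2" for R w
    proof -
      have "1 \<le> card (nb X k)" if "k \<in> R - {w}" for k
        using triangle_degree[OF \<open>tri R\<close> \<open>R \<subseteq> W\<close>, of k]
          \<open>\<And>k. k \<in> R - {w} \<Longrightarrow> card (nb W k) \<le> card (nb X k) + 2\<close>[of k] that by auto
      then have "(\<Sum>k\<in>R - {w}. 1) \<le> arcs (R - {w}) X"
        unfolding arcs_def by (rule sum_mono)
      also have "\<dots> \<le> arcs R X"
        using tri_finite[OF that(1)] by (intro arcs_mono_left) auto
      finally show ?thesis
        using that(1,3) by (simp add: tri_card tri_finite)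
    qed
    have "2 \<le> arcs S X" "2 \<le> arcs T X"
      using half[OF c(1) _ c(5,7)] half[OF c(2) _ c(6,8)] \<open>K \<subseteq> W\<close> c(4) by auto
    then show ?thesis
      using c(1-4) by (simp add: arcs_Un_left tri_finite)
  qed
qed

lemma degree_ge_3:
  assumes "v \<in> W"
  shows "3 \<le> card (nb W v)"
proof (rule ccontr)
  assume "\<not> ?thesis"
  then have "card (nb W v) = 2"
    using degree_ge_2[OF assms] by simp
  then obtain u w where nbv: "nb W v = {u, w}" "u \<noteq> w"
    by (meson card_2_iff)
  then have u: "u \<in> W" "adj v u" and w: "w \<in> W" "adj v w"
    using in_nb[of u W v] in_nb[of w W v] by auto
  have nonadj: "\<not> adj u w"
    using triangle_degree[of "{v, u, w}" v] triI[of v u w] u w assms \<open>card (nb W v) = 2\<close> by auto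
  let ?X = "{v, u, w}"
  have X: "?X \<subseteq> W" using assms u w by simp
  have d: "v \<noteq> u" "v \<noteq> w" using u w adj_neq by auto
  have "nb ?X v = {u, w}" "nb ?X u = {v}" "nb ?X w = {v}"
    using u w nonadj adj_sym adj_irrefl by auto
  then have XX: "arcs ?X ?X = 4"
    using d nbv(2) by (simp add: arcs_def)
  moreover have "(\<Sum>x\<in>?X. card (nb W x)) = 2 + card (nb W u) + card (nb W w)"
    using d nbv(2) \<open>card (nb W v) = 2\<close> by simp
  \<comment> \<open>Inside \<open>?X\<close> the vertices \<open>u\<close> and \<open>w\<close> are
    adjacent only to \<open>v\<close>, so each sends an edge out.\<close>
  ultimately have "2 \<le> arcs ?X (W - ?X)"
    using sum_degree_split[OF finite_W X] degree_ge_2[OF u(1)] degree_ge_2[OF w(1)] by simp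
  then show False
    using q nbv d XX X cut_ge[OF X] by (intro reduce[of ?X "{v}"]) (auto simp: penalty_def adj_irrefl)
qed

text \<open>A difficult component contains a triangle of degree sum at most 7 plus its edges to
  \<open>X\<close>. Each vertex of \<open>B\<close> receives at most one of these edges, so
  \<open>3 * d \<le> card B + 7\<close>.\<close>

lemma penalty_eq_0:
  assumes "X \<subseteq> W" "B \<subseteq> X" "\<And>k. k \<in> W - X \<Longrightarrow> nb X k \<subseteq> B"
    and "\<And>x. x \<in> W \<Longrightarrow> d \<le> card (nb W x)" "card B + 7 < 3 * d"
  shows "penalty (W - X) = 0"
proof -
  have finX: "finite X"
    using assms(1) finite_W finite_subset by blast
  have "tricomps (W - X) \<union> chaincomps (W - X) = {}"
  proof (rule ccontr)
    assume "\<not> ?thesis"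
    then obtain K where K: "K \<in> tricomps (W - X) \<union> chaincomps (W - X)" by blast
    obtain T where T: "tri T" "T \<subseteq> K" "(\<Sum>k\<in>T. card (nb W k)) \<le> arcs T X + 7"
      using dcomp_tri[OF K finX] by metis
    have TX: "T \<subseteq> W - X"
      using dcomp_closed(1)[OF K] T(2) by blast
    have "(\<Sum>k\<in>T. d) \<le> (\<Sum>k\<in>T. card (nb W k))"
      using TX assms(4) by (intro sum_mono) auto
    then have "3 * d \<le> arcs T X + 7"
      using T by (simp add: tri_card)
    moreover have "arcs T X \<le> card B"
      using TX finX assms(2,3) by (intro arcs_tri_le[OF T(1)]) auto
    ultimately show False
      using assms(5) by simp
  qed
  then show ?thesis
    by (simp add: penalty_def)
qed

text \<open>Here \<open>I\<close> is empty: deleting \<open>v\<close> alone creates no penalty, and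
  the edges at \<open>v\<close> pay for it once \<open>r \<le> 3 * card (nb W v)\<close>.\<close>

lemma degree_bound:
  assumes "v \<in> W"
  shows "3 * card (nb W v) < r"
proof (rule ccontr)
  assume "\<not> ?thesis"
  moreover have "penalty (W - {v}) = 0"
    using assms degree_ge_3 by (intro penalty_eq_0[of "{v}" "{v}" 3]) (auto simp: nb_def)
  moreover have "arcs {v} {v} + arcs {v} (W - {v}) = card (nb W v)"
    using sum_degree_split[OF finite_W, of "{v}"] assms by simp
  moreover have "arcs {v} {v} = 0"
    by (simp add: arcs_def nb_def adj_irrefl)
  ultimately show False
    using assms by (intro reduce[of "{v}" "{}"]) auto
qed

section \<open>Deleting closed neighbourhoods\<close>

lemma nonempty: "W \<noteq> {}"
  using not_good by (auto simp: good_def)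

text \<open>By \<open>diamond_free\<close> a neighbourhood induces a matching.\<close>

lemma nbhd_arcs_le:
  assumes "v \<in> W"
  shows "arcs (nb W v) (nb W v) \<le> card (nb W v)"
proof -
  have "card (nb (nb W v) u) \<le> 1" if "u \<in> nb W v" for u
  proof -
    have "x = y" if "x \<in> nb (nb W v) u" "y \<in> nb (nb W v) u" for x y
      using that \<open>u \<in> nb W v\<close> diamond_free[of v u x y] by simp
    then show ?thesis
      using finite_W by (simp add: card_le_Suc0_iff_eq)
  qed
  then have "arcs (nb W v) (nb W v) \<le> (\<Sum>u\<in>nb W v. 1)"
    unfolding arcs_def by (rule sum_mono)
  then show ?thesis by simp
qed

text \<open>The last inequality says that deleting the closed neighbourhood with
  \<open>I = {v}\<close> is not a valid reduction; the equations evaluate its terms.\<close>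

lemma nbhd_counts:
  fixes v
  defines "N \<equiv> nb W v"
  defines "X \<equiv> insert v N"
  assumes v: "v \<in> W"
  shows "arcs X X = 2 * card N + arcs N N"
    and "(\<Sum>u\<in>N. card (nb W u)) = card N + arcs N N + arcs X (W - X)"
    and "2 * q + 3 * (arcs X X + 2 * arcs X (W - X)) < 2 * r * (card N + 1) + 2 * penalty (W - X)"
proof -
  have X: "X \<subseteq> W" and fin: "finite N" "finite X" and vN: "v \<notin> N"
    using v finite_W by (auto simp: X_def N_def adj_irrefl)
  have "arcs {v} {v} = 0" "X - {v} = N" "nb N v = N"
    using vN by (auto simp: arcs_def nb_def adj_irrefl X_def N_def)
  moreover have "arcs {v} N = card (nb N v)"
    by (simp add: arcs_def)
  ultimately show XX: "arcs X X = 2 * card N + arcs N N"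
    using arcs_split[of X "{v}"] fin(2) by (simp add: X_def)
  have "(\<Sum>x\<in>X. card (nb W x)) = card N + (\<Sum>u\<in>N. card (nb W u))"
    using vN fin unfolding X_def by (subst sum.insert) (auto simp: N_def)
  then show "(\<Sum>u\<in>N. card (nb W u)) = card N + arcs N N + arcs X (W - X)"
    using sum_degree_split[OF finite_W X] XX by simp
  show "2 * q + 3 * (arcs X X + 2 * arcs X (W - X)) < 2 * r * (card N + 1) + 2 * penalty (W - X)"
  proof (rule ccontr)
    assume "\<not> ?thesis"
    then show False
      using X vN fin by (intro reduce[of X "{v}"]) (auto simp: X_def N_def adj_irrefl)
  qed
qed

text \<open>Each vertex of \<open>K\<close> needs a third neighbour, which lies in
  \<open>nb W v\<close>. These neighbours are distinct by \<open>tri_one_nb\<close>, so they exhaust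
  the three neighbours of \<open>v\<close>.\<close>

lemma tricomp_nbhd:
  assumes "v \<in> W" "card (nb W v) = 3" "K \<in> tricomps (W - insert v (nb W v))" "u \<in> nb W v"
  obtains k where "k \<in> K" "adj u k"
proof -
  let ?N = "nb W v" and ?X = "insert v (nb W v)"
  have K: "tri K" "K \<subseteq> W - ?X"
    using assms(3) by (auto simp: tricomps_def closed_in_def)
  have fin: "finite ?N" "finite ?X"
    using finite_W by auto
  have nbX: "nb ?X k \<subseteq> ?N" if "k \<in> K" for k
    using that K(2) adj_sym[of k v] by (auto simp: nb_def)
  have "1 \<le> card (nb ?X k)" if "k \<in> K" for k
    using tricomp_degree[OF assms(3) fin(2) that] degree_ge_3[of k] K(2) that by auto
  then have "(\<Sum>k\<in>K. 1) \<le> arcs K ?X"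
    unfolding arcs_def by (rule sum_mono)
  then have "card ?N \<le> card (\<Union>k\<in>K. nb ?X k)"
    using K fin arcs_tri[of K ?X] assms(2) by (simp add: tri_card disjoint_iff subset_iff)
  then have "(\<Union>k\<in>K. nb ?X k) = ?N"
    using nbX fin(1) by (intro card_seteq) auto
  then show ?thesis
    using assms(4) that adj_sym by (metis UN_E in_nb)
qed

text \<open>For an edge \<open>u w\<close> in the neighbourhood, the neighbours of \<open>u\<close>
  and \<open>w\<close> in \<open>K\<close> give a second triangle on \<open>u w\<close> or a 4-cycle
  through it, while \<open>u w v\<close> is a triangle.\<close>

lemma no_tricomp_nbhd:
  assumes "v \<in> W" "card (nb W v) = 3" "arcs (nb W v) (nb W v) \<noteq> 0"
  shows "tricomps (W - insert v (nb W v)) = {}"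
proof (rule ccontr)
  assume "\<not> ?thesis"
  then obtain K where K: "K \<in> tricomps (W - insert v (nb W v))" by blast
  obtain u w where uw: "u \<in> nb W v" "w \<in> nb W v" "adj u w"
    using arcs_neq_0E[OF assms(3)] .
  obtain k l where kl: "k \<in> K" "adj u k" "l \<in> K" "adj w l"
    using tricomp_nbhd[OF assms(1,2) K] uw(1,2) by metis
  have out: "k \<noteq> w" "l \<noteq> u" "k \<noteq> v"
    using kl uw K by (auto simp: tricomps_def closed_in_def)
  show False
  proof (cases "k = l")
    case True
    then show False
      using diamond_free[of u w v k] uw kl out adj_sym by simp
  next
    case False
    then have "adj k l"
      using K kl tri_adj by (auto simp: tricomps_def)
    then show False
      using house_free[of u w v l k] uw kl out adj_sym by simp
  qed
qed

end

section \<open>Degrees 3 and 4\<close>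

locale minimal_bad_15 = minimal_bad +
  assumes r15: "r = 15"
begin

lemma degree_cases: "v \<in> W \<Longrightarrow> card (nb W v) = 3 \<or> card (nb W v) = 4"
  using degree_ge_3[of v] degree_bound[of v] r15 by linarith

text \<open>The failed reduction bounds the edges leaving \<open>?X\<close> from above, given the
  penalty, which \<open>cut_ge\<close> bounds in turn. The degree sum over the neighbours is then
  exactly 9; without edges among them, six edges leave \<open>?X\<close>, too many unless a triangle
  component appears.\<close>

lemma cubic_nbhd:
  assumes v: "v \<in> W" "card (nb W v) = 3"
  shows "u \<in> nb W v \<Longrightarrow> card (nb W u) = 3"
    and "arcs (nb W v) (nb W v) = 0 \<Longrightarrow> tricomps (W - insert v (nb W v)) \<noteq> {}"
proof -
  let ?N = "nb W v"
  let ?X = "insert v ?N"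
  let ?s = "\<Sum>u\<in>?N. card (nb W u)"
  have fin: "finite ?N" and X: "?X \<subseteq> W"
    using finite_W v(1) by auto
  note counts = nbhd_counts[OF v(1), unfolded v(2)]
  have cut: "3 * card (tricomps (W - ?X)) + 4 * card (chaincomps (W - ?X)) \<le> arcs ?X (W - ?X)"
    by (rule cut_ge[OF X])
  have pen: "penalty (W - ?X) = 2 * card (tricomps (W - ?X)) + card (chaincomps (W - ?X))"
    by (simp add: penalty_def)
  \<comment> \<open>The value is even and at most 3.\<close>
  have h: "arcs ?N ?N = 0 \<or> arcs ?N ?N = 2"
  proof -
    obtain k where "arcs ?N ?N = 2 * k"
      using even_arcs[OF fin] by (rule evenE)
    then show ?thesis
      using nbhd_arcs_le[OF v(1)] v(2) by arith
  qed
  have q34: "q = 34" using q r15 by simp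
  have deg: "3 \<le> card (nb W u)" if "u \<in> ?N" for u
    using that degree_ge_3 by simp
  have t: "arcs ?N ?N = 2 \<Longrightarrow> tricomps (W - ?X) = {}"
    using no_tricomp_nbhd[OF v] by simp
  have ineq: "34 + 2 * penalty (W - ?X) > 3 * arcs ?N ?N + 6 * arcs ?X (W - ?X)"
    using counts(1,3) q34 r15 by simp
  have s9: "?s \<le> 9"
  proof (rule ccontr)
    assume "\<not> ?thesis"
    then have big: "10 \<le> ?s" by simp
    from h show False
    proof
      assume "arcs ?N ?N = 0"
      \<comment> \<open>\<open>t\<close>, \<open>k\<close>, \<open>c\<close> stand for triangle
        components, 2-chain components and edges leaving \<open>?X\<close>. Integrality leaves
        \<open>c = 7\<close>, \<open>k = 0\<close>, \<open>t \<le> 2\<close>, where the last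
        hypothesis would need 42 < 42.\<close>
      moreover have False if "3 * t + 4 * k \<le> c" "7 \<le> c" "6 * c < 34 + 2 * (2 * t + k)" for t k c :: nat
      proof -
        have "14 * c + 10 * k \<le> 99" using that by simp
        then have "c = 7" "k = 0" using that(2) by linarith+
        then show False using that(1,3) by simp
      qed
      ultimately show False
        using counts(2) ineq cut pen big by simp
    next
      assume "arcs ?N ?N = 2"
      then show False using counts(2) ineq cut pen big t by simp
    qed
  qed
  have s_ge: "9 \<le> ?s"
    using sum_mono[of ?N "\<lambda>_. 3" "\<lambda>u. card (nb W u)"] deg v(2) by simp
  show "card (nb W u) = 3" if u: "u \<in> ?N"
  proof (rule ccontr)
    assume "card (nb W u) \<noteq> 3"
    then have "4 \<le> card (nb W u)" using deg[OF u] by simp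
    moreover have "6 \<le> (\<Sum>u\<in>?N - {u}. card (nb W u))"
      using sum_mono[of "?N - {u}" "\<lambda>_. 3" "\<lambda>u. card (nb W u)"] deg v(2) u fin by simp
    ultimately show False
      using s9 sum.remove[OF fin u, of "\<lambda>u. card (nb W u)"] by simp
  qed
  show "tricomps (W - ?X) \<noteq> {}" if "arcs ?N ?N = 0"
  proof
    assume none: "tricomps (W - ?X) = {}"
    then have "card (chaincomps (W - ?X)) \<le> 1"
      using ineq cut pen by simp
    then show False
      using that none counts(2) ineq pen s_ge by simp
  qed
qed

text \<open>\<open>x\<close> has degree 3, used up by \<open>v\<close> and its triangle, yet it has
  a neighbour in a triangle component \<open>K\<close>. So \<open>K\<close> contains both other
  vertices of \<open>T\<close>, against \<open>tri_one_nb\<close>.\<close>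

lemma cubic_nb_not_in_triangle:
  assumes v: "v \<in> W" "card (nb W v) = 3" "arcs (nb W v) (nb W v) = 0"
    and x: "x \<in> nb W v" and T: "tri T" "T \<subseteq> W" "x \<in> T"
  shows False
proof -
  obtain K where K: "K \<in> tricomps (W - insert v (nb W v))"
    using cubic_nbhd(2)[OF v] by blast
  then have tK: "tri K" and clK: "closed_in (W - insert v (nb W v)) K"
    by (auto simp: tricomps_def)
  obtain k where k: "k \<in> K" "adj x k"
    using tricomp_nbhd[OF v(1,2) K x] by blast
  obtain y z where yz: "T = {x, y, z}" "adj x y" "adj y z" "adj x z"
    using triE[OF T(1,3)] by metis
  have no: "\<not> adj a b" if "a \<in> nb W v" "b \<in> nb W v" for a b
    using arcs_eq_0[OF _ _ v(3)] that finite_W by simp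
  have yN: "y \<notin> nb W v" "z \<notin> nb W v"
    using no x yz by blast+
  have W: "y \<in> W" "z \<in> W" "k \<in> W"
    using T(2) yz(1) clK k(1) by (auto simp: closed_in_def)
  have kv: "k \<noteq> v" "k \<notin> nb W v"
    using clK k(1) by (auto simp: closed_in_def)
  have yv: "y \<noteq> v" "z \<noteq> v"
    using yN yz(3) W adj_sym by auto
  have "card (nb W x) = 3"
    by (rule cubic_nbhd(1)[OF v(1,2) x])
  moreover have "{v, y, z} \<subseteq> nb W x" "card {v, y, z} = 3"
    using x v(1) W yz yv adj_sym adj_neq by auto
  ultimately have "nb W x = {v, y, z}"
    using finite_W card_seteq[of "nb W x" "{v, y, z}"] by simp
  then have "k = y \<or> k = z"
    using k(2) W(3) kv(1) by (auto simp: set_eq_iff)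
  moreover have "nb (W - insert v (nb W v)) k \<subseteq> K"
    using clK k(1) by (auto simp: closed_in_def)
  ultimately have "y \<in> K" "z \<in> K"
    using k(1) yz(3) W yN yv adj_sym[OF yz(3)] by (auto simp: subset_iff)
  moreover have "x \<notin> K"
    using clK x by (auto simp: closed_in_def)
  ultimately show False
    using tri_one_nb[OF tK, of x y z] yz(2-4) adj_neq by blast
qed

text \<open>
  If \<open>v\<close> is in no triangle, some component \<open>K\<close> left by its closed neighbourhood is a triangle, and
  the previous lemma applies to a neighbour of \<open>v\<close> and \<open>K\<close>.
\<close>

lemma cubic_in_triangle:
  assumes v: "v \<in> W" "card (nb W v) = 3"
  obtains y z where "y \<in> W" "z \<in> W" "adj v y" "adj y z" "adj v z"
proof (cases "arcs (nb W v) (nb W v) = 0")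
  case False
  then obtain y z where "y \<in> nb W v" "z \<in> nb W v" "adj y z"
    by (rule arcs_neq_0E)
  then show ?thesis
    using that[of y z] by simp
next
  case True
  obtain K where K: "K \<in> tricomps (W - insert v (nb W v))"
    using cubic_nbhd(2)[OF v True] by blast
  then have tK: "tri K" and clK: "closed_in (W - insert v (nb W v)) K"
    by (auto simp: tricomps_def)
  obtain u where u: "u \<in> nb W v"
    using v(2) by (metis card.empty equals0I zero_neq_numeral)
  obtain k where k: "k \<in> K" "adj u k"
    using tricomp_nbhd[OF v K u] by blast
  have uW: "u \<in> W" "k \<in> W" "K \<subseteq> W" and d: "card (nb W u) = 3" "k \<noteq> v" "u \<notin> K" "\<not> adj v k"
    using u k clK cubic_nbhd(1)[OF v u] by (auto simp: closed_in_def)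
  have no: "\<not> adj a b" if "a \<in> nb W v" "b \<in> nb W v" for a b
    using arcs_eq_0[OF _ _ True] that finite_W by simp
  \<comment> \<open>A triangle \<open>u a b\<close> avoids \<open>v\<close>, so degree 3 forces
    \<open>k\<close> to be \<open>a\<close> or \<open>b\<close>; then both lie in \<open>K\<close>,
    against \<open>tri_one_nb\<close>.\<close>
  have "arcs (nb W u) (nb W u) = 0"
  proof (rule ccontr)
    assume "\<not> ?thesis"
    then obtain a b where ab: "a \<in> nb W u" "b \<in> nb W u" "adj a b"
      by (rule arcs_neq_0E)
    have nv: "\<not> adj v c" if "c \<in> nb W u" for c
      using no[OF u, of c] that by auto
    have "a \<noteq> v" "b \<noteq> v"
      using nv[OF ab(2)] nv[OF ab(1)] ab(3) adj_sym[OF ab(3)] by auto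
    have step: "y \<in> K" if "x \<in> K" "y \<in> nb W u" "y \<noteq> v" "adj x y" for x y
    proof -
      have "y \<in> nb (W - insert v (nb W v)) x"
        using that nv[OF that(2)] by simp
      then show ?thesis
        using clK that(1) unfolding closed_in_def by blast
    qed
    have "a \<in> K \<Longrightarrow> b \<in> K" "b \<in> K \<Longrightarrow> a \<in> K"
      using step ab \<open>a \<noteq> v\<close> \<open>b \<noteq> v\<close> adj_sym[OF ab(3)] by blast+
    moreover have "a = k \<or> b = k"
    proof (rule ccontr)
      assume "\<not> ?thesis"
      then have "card {v, k, a, b} = 4"
        using d \<open>a \<noteq> v\<close> \<open>b \<noteq> v\<close> adj_neq[OF ab(3)] by auto
      moreover have "{v, k, a, b} \<subseteq> nb W u"
        using ab u k uW v(1) adj_sym by auto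
      ultimately show False
        using card_mono[of "nb W u" "{v, k, a, b}"] finite_W d(1) by simp
    qed
    ultimately show False
      using tri_one_nb[OF tK d(3), of a b] ab k adj_neq[OF ab(3)] by auto
  qed
  then show ?thesis
    using cubic_nb_not_in_triangle[of u k K] uW d(1) k tK by simp
qed

lemma cubic_third:
  assumes v: "v \<in> W" "card (nb W v) = 3" and bc: "b \<in> nb W v" "c \<in> nb W v" "b \<noteq> c"
  obtains d where "nb W v = {b, c, d}" "d \<noteq> b" "d \<noteq> c"
proof -
  have "card (nb W v - {b, c}) = 1"
    using v(2) bc finite_W by (simp add: card_Diff_subset)
  then obtain d where "nb W v - {b, c} = {d}"
    by (rule card_1_singletonE)
  then have "nb W v = {b, c, d}" "d \<noteq> b" "d \<noteq> c"
    using bc(1,2) by blast+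
  then show ?thesis by (rule that)
qed

text \<open>
  The triangles \<open>a b c\<close> and \<open>u p m\<close> are joined by the edge \<open>a u\<close>, and \<open>w\<close> is the third neighbour
  of \<open>p\<close>. These seven vertices induce exactly eight edges, and deleting them with \<open>I = {a, p}\<close> is a
  valid reduction.
\<close>

lemma no_cubic:
  assumes "a \<in> W"
  shows "card (nb W a) \<noteq> 3"
proof
  assume a3: "card (nb W a) = 3"
  have cubic: "card (nb W y) = 3" if "x \<in> W" "card (nb W x) = 3" "y \<in> W" "adj x y" for x y
    using cubic_nbhd(1)[OF that(1,2), of y] that(3,4) by simp
  obtain b c where bc: "b \<in> W" "c \<in> W" "adj a b" "adj b c" "adj a c"
    using cubic_in_triangle[OF assms a3] .
  have sym: "adj b a" "adj c a" "adj c b"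
    using bc adj_sym by blast+
  have ne: "a \<noteq> b" "b \<noteq> c" "a \<noteq> c"
    using bc adj_neq by blast+
  obtain u where nba: "nb W a = {b, c, u}" and u: "u \<noteq> b" "u \<noteq> c"
    using cubic_third[OF assms a3, of b c] bc ne by auto
  have adj_a: "adj a x \<longleftrightarrow> x = b \<or> x = c \<or> x = u" if "x \<in> W" for x
    using nba that by (auto simp: nb_def set_eq_iff)
  have uW: "u \<in> W" "adj a u" "adj u a" "u \<noteq> a"
    using adj_a[of u] adj_sym[of a u] adj_neq[of a u] nba nb_subset[of W a] by auto
  have u3: "card (nb W u) = 3"
    using cubic[OF assms a3 uW(1,2)] .
  have nub: "\<not> adj u b" "\<not> adj u c"
    using diamond_free[of a b c u] diamond_free[of a c b u] bc sym uW u adj_sym by blast+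
  obtain p m where pq: "p \<in> W" "m \<in> W" "adj u p" "adj p m" "adj u m"
    using cubic_in_triangle[OF uW(1) u3] .
  have pq_sym: "adj p u" "adj m u" "adj m p" and pq_ne: "p \<noteq> m" "p \<noteq> u" "m \<noteq> u"
    using pq adj_sym adj_neq by blast+
  have pq_abc: "p \<noteq> b" "p \<noteq> c" "m \<noteq> b" "m \<noteq> c"
    using pq nub by blast+
  have pqa: "p \<noteq> a" "m \<noteq> a"
    using adj_a[OF pq(2)] adj_a[OF pq(1)] pq(4) pq_sym(3) pq_abc pq_ne by blast+
  obtain d where "nb W u = {p, m, d}" "d \<noteq> p" "d \<noteq> m"
    using cubic_third[OF uW(1) u3, of p m] pq pq_ne by auto
  then have nbu: "nb W u = {a, p, m}"
    using uW(3) assms pqa by (auto simp: nb_def set_eq_iff)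
  have adj_u: "adj u x \<longleftrightarrow> x = a \<or> x = p \<or> x = m" if "x \<in> W" for x
    using nbu that by (auto simp: nb_def set_eq_iff)
  have p3: "card (nb W p) = 3"
    using cubic[OF uW(1) u3 pq(1,3)] .
  obtain w where nbp: "nb W p = {u, m, w}" and w: "w \<noteq> u" "w \<noteq> m"
    using cubic_third[OF pq(1) p3, of u m] pq pq_sym pq_ne uW by auto
  have adj_p: "adj p x \<longleftrightarrow> x = u \<or> x = m \<or> x = w" if "x \<in> W" for x
    using nbp that by (auto simp: nb_def set_eq_iff)
  have wW: "w \<in> W" "adj p w" "adj w p" "w \<noteq> p"
    using adj_p[of w] adj_sym[of p w] adj_neq[of p w] nbp nb_subset[of W p] by auto
  have w3: "card (nb W w) = 3"
    using cubic[OF pq(1) p3 wW(1,2)] .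
  have ap: "\<not> adj a p" "\<not> adj a m" "\<not> adj p a" "\<not> adj m a"
    using adj_a pq pq_abc pq_ne adj_sym by blast+
  have wa: "w \<noteq> a"
    using ap wW by blast
  have uw: "\<not> adj u w" "\<not> adj w u"
    using adj_u[OF wW(1)] wa wW(4) w adj_sym by blast+
  have qw: "\<not> adj m w" "\<not> adj w m"
    using diamond_free[of p m u w] pq pq_sym wW w adj_sym by blast+
  have far: "\<not> adj y p \<and> \<not> adj y m \<and> \<not> adj y w"
    if y: "y \<in> W" "z \<in> W" "adj a y" "adj y z" "adj a z" "y \<noteq> u" "z \<noteq> u" "w \<noteq> y" "w \<noteq> z" for y z
  proof -
    have s: "adj y a" "adj z a" "adj z y"
      using y adj_sym by blast+
    have yp: "\<not> adj y p"
      using house_free[of a y z p u] y s pq_sym uW pqa by blast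
    have yq: "\<not> adj y m"
      using house_free[of a y z m u] y s pq_sym uW pqa by blast
    \<comment> \<open>Neither \<open>p\<close> nor \<open>y\<close> lies in the triangle
      \<open>w g h\<close> at \<open>w\<close>, so \<open>w\<close> would have the four neighbours
      \<open>p\<close>, \<open>y\<close>, \<open>g\<close>, \<open>h\<close>.\<close>
    have "\<not> adj y w"
    proof
      assume yw: "adj y w"
      have "card (nb W y) = 3"
        using cubic[OF assms a3 y(1,3)] .
      then obtain e where "nb W y = {a, z, e}"
        using cubic_third[OF y(1), of a z] s y assms adj_irrefl by (metis in_nb)
      then have adj_y: "x = a \<or> x = z \<or> x = w" if "x \<in> W" "adj y x" for x
        using that yw wa y(9) wW(1) by (auto simp: nb_def set_eq_iff)
      obtain g h where gh: "g \<in> W" "h \<in> W" "adj w g" "adj g h" "adj w h"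
        using cubic_in_triangle[OF wW(1) w3] .
      have py: "p \<noteq> y" using y ap by blast
      have np: "\<not> adj p x" if "x \<in> W" "adj w x" for x
        using adj_p[OF that(1)] that uw qw adj_irrefl by blast
      have "\<not> adj w z"
        using diamond_free[of y z a w] s y yw wa adj_sym by blast
      moreover have "\<not> adj w a"
        using adj_a[OF wW(1)] y(8,9) w(1) adj_sym bc y(3,5) adj_a[OF y(1)] adj_a[OF y(2)] y(6,7) adj_neq[OF y(4)] by metis
      ultimately have ny: "\<not> adj y x" if "x \<in> W" "adj w x" for x
        using adj_y[OF that(1)] that adj_irrefl by blast
      have "g \<noteq> p" "h \<noteq> p" "g \<noteq> y" "h \<noteq> y"
        using np gh ny adj_sym by blast+
      then have "card {p, y, g, h} = 4"
        using py adj_neq[OF gh(4)] by auto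
      moreover have "{p, y, g, h} \<subseteq> nb W w"
        using gh wW pq y(1) yw adj_sym by auto
      ultimately show False
        using card_mono[of "nb W w" "{p, y, g, h}"] finite_W w3 by simp
    qed
    with yp yq show ?thesis by blast
  qed
  have wbc: "w \<noteq> b" "w \<noteq> c"
    using house_free[of a b c p u] house_free[of a c b p u] bc sym uW u pq_sym pqa wW by blast+
  have fb: "\<not> adj b p" "\<not> adj b m" "\<not> adj b w"
    using far[of b c] bc u wbc by blast+
  have fc: "\<not> adj c p" "\<not> adj c m" "\<not> adj c w"
    using far[of c b] bc sym u wbc by blast+
  have aw: "\<not> adj a w"
    using adj_a[OF wW(1)] wbc w by blast
  let ?X = "{a, b, c, u, p, m, w}"
  have X: "?X \<subseteq> W" using assms bc uW pq wW by simp
  have dist: "distinct [a, b, c, u, p, m, w]"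
    using ne u uW pq_ne pq_abc pqa w wW wa wbc by auto
  have no: "\<not> adj p b" "\<not> adj m b" "\<not> adj w b" "\<not> adj p c" "\<not> adj m c" "\<not> adj w c" "\<not> adj w a"
    "\<not> adj b u" "\<not> adj c u"
    using fb fc aw nub adj_sym by blast+
  have nbs: "nb ?X a = {b, c, u}" "nb ?X b = {a, c}" "nb ?X c = {a, b}" "nb ?X u = {a, p, m}"
    "nb ?X p = {u, m, w}" "nb ?X m = {u, p}" "nb ?X w = {p}"
    unfolding nb_def using bc sym uW nub pq pq_sym ap uw qw wW fb fc aw no adj_irrefl by auto
  have XX: "arcs ?X ?X = 16"
    unfolding arcs_def using dist by (simp add: nbs)
  have deg: "card (nb W b) = 3" "card (nb W c) = 3" "card (nb W m) = 3"
    using cubic[OF assms a3] cubic[OF uW(1) u3] bc pq by blast+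
  have "(\<Sum>x\<in>?X. card (nb W x)) = 21"
    using dist a3 u3 p3 w3 deg by simp
  then have cut: "arcs ?X (W - ?X) = 5"
    using sum_degree_split[OF finite_W X] XX by simp
  have "3 * card (tricomps (W - ?X)) + 4 * card (chaincomps (W - ?X)) \<le> 5"
    using cut_ge[OF X] cut by simp
  then have "card (tricomps (W - ?X)) + card (chaincomps (W - ?X)) \<le> 1"
    by simp
  then have pen: "penalty (W - ?X) \<le> 2"
    unfolding penalty_def by simp
  have card: "card ?X = 7" "card {a, p} = 2"
    using distinct_card[OF dist] pqa by simp_all
  show False
  proof (rule reduce[OF X, of "{a, p}"])
    show "nb W x \<subseteq> ?X" if "x \<in> {a, p}" for x
      using that nba nbp by auto
    show "\<not> adj x y" if "x \<in> {a, p}" "y \<in> {a, p}" for x y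
      using that ap adj_irrefl by auto
    \<comment> \<open>With penalty 2 both sides are 214.\<close>
    have "2 * r * 7 + 2 * penalty (W - ?X) \<le> 2 * q * 2 + 3 * (16 + 2 * 5)" 
      using pen r15 q by simp
    then show "2 * r * card ?X + 2 * penalty (W - ?X) \<le>
        2 * q * card {a, p} + 3 * (arcs ?X ?X + 2 * arcs ?X (W - ?X))"
      by (simp only: XX cut card)
  qed auto
qed

lemma contradiction: False
proof -
  have deg: "card (nb W v) = 4" if "v \<in> W" for v
    using degree_cases[OF that] no_cubic[OF that] by simp
  obtain v where v: "v \<in> W"
    using nonempty by blast
  let ?N = "nb W v"
  let ?X = "insert v ?N"
  have X: "?X \<subseteq> W"
    using v by auto
  have "penalty (W - ?X) = 0"
  proof (rule penalty_eq_0[of ?X ?N 4])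
    show "nb ?X k \<subseteq> ?N" if "k \<in> W - ?X" for k
      using that adj_sym[of k v] by (auto simp: nb_def)
  qed (use X deg v in auto)
  moreover have "(\<Sum>u\<in>?N. card (nb W u)) = 16"
    using deg v by simp
  \<comment> \<open>If \<open>h\<close> is \<open>arcs ?N ?N\<close>, then \<open>12 - h\<close>
    edges leave \<open>?X\<close>, and the failed reduction reads \<open>164 - 3 * h < 150\<close>,
    against \<open>h \<le> 4\<close>.\<close>
  ultimately show False
    using nbhd_counts[OF v] nbhd_arcs_le[OF v] deg[OF v] r15 q by simp
qed

end

section \<open>The two main inequalities, by induction over finite vertex sets\<close>

context sparse_triangles
begin

text \<open>For \<open>r = 8\<close> the bound \<open>3 * card (nb W v) < r\<close> allows degree at
  most 2, against \<open>degree_ge_3\<close>.\<close>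

lemma good_13:
  assumes "finite W"
  shows "good 8 13 W"
  using assms
proof (induction W rule: finite_psubset_induct)
  case (psubset W)
  show ?case
  proof (rule ccontr)
    assume "\<not> good 8 13 W"
    then interpret minimal_bad adj W 8 13
      using psubset by unfold_locales auto
    obtain v where "v \<in> W"
      using nonempty by blast
    then show False
      using degree_ge_3[of v] degree_bound[of v] by simp
  qed
qed

lemma good_34:
  assumes "finite W"
  shows "good 15 34 W"
  using assms
proof (induction W rule: finite_psubset_induct)
  case (psubset W)
  show ?case
  proof (rule ccontr)
    assume "\<not> good 15 34 W"
    then interpret minimal_bad_15 adj W 15 34
      using psubset by unfold_locales auto
    show False
      by (rule contradiction)
  qed
qed

end

section \<open>Back to sets of edges\<close>

lemma cycle_edges_3: "cycle_edges [x, y, z] = {{x, y}, {y, z}, {z, x}}"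
proof -
  have "{i. i < length [x, y, z]} = {0, 1, 2}" by auto
  then have "cycle_edges [x, y, z] = (\<lambda>i. {[x, y, z] ! i, [x, y, z] ! (Suc i mod 3)}) ` {0, 1, 2}"
    unfolding cycle_edges_def by (simp add: setcompr_eq_image)
  then show ?thesis by simp
qed

lemma cycle_edges_4: "cycle_edges [x, y, z, w] = {{x, y}, {y, z}, {z, w}, {w, x}}"
proof -
  have "{i. i < length [x, y, z, w]} = {0, 1, 2, 3}" by auto
  then have "cycle_edges [x, y, z, w] =
      (\<lambda>i. {[x, y, z, w] ! i, [x, y, z, w] ! (Suc i mod 4)}) ` {0, 1, 2, 3}"
    unfolding cycle_edges_def by (simp add: setcompr_eq_image)
  then show ?thesis by simp
qed

locale sparse_graph =
  fixes V :: "'a set" and E :: "'a set set"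
  assumes graph: "fin_simple_graph V E"
    and no_shared: "no_triangle_shares_edge_with_C4 E"
begin

lemma finite_V: "finite V"
  using graph by (simp add: fin_simple_graph_def)

lemma edge: "{x, y} \<in> E \<Longrightarrow> x \<in> V \<and> y \<in> V \<and> x \<noteq> y"
  using graph unfolding fin_simple_graph_def by (metis doubleton_in_nsets_2 subsetD)

lemma edgeE:
  assumes "e \<in> E"
  obtains x y where "e = {x, y}" "x \<in> V" "y \<in> V" "x \<noteq> y"
  using assms graph unfolding fin_simple_graph_def by (meson nsets2_E subsetD)

lemma finite_E: "finite E"
  using graph unfolding fin_simple_graph_def by (meson finite_imp_finite_nsets finite_subset)

sublocale sparse_triangles "\<lambda>x y. {x, y} \<in> E"
proof
  show "\<not> {x, x} \<in> E" for x
    using edge[of x x] by blast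
  show "{y, x} \<in> E" if "{x, y} \<in> E" for x y
    using that by (simp add: insert_commute)
  fix x y z u v
  assume *: "{x, y} \<in> E" "{y, z} \<in> E" "{x, z} \<in> E" "{y, u} \<in> E" "{u, v} \<in> E" "{v, x} \<in> E" "u \<noteq> x" "v \<noteq> y"
  \<comment> \<open>Both cycles contain the edge \<open>{x, y}\<close>.\<close>
  have "is_cycle E [x, y, z]" "is_cycle E [x, y, u, v]"
    using * edge[OF *(1)] edge[OF *(2)] edge[OF *(3)] edge[OF *(4)] edge[OF *(5)] edge[OF *(6)]
    unfolding is_cycle_def cycle_edges_3 cycle_edges_4 by (auto simp: insert_commute)
  then have "cycle_edges [x, y, z] \<inter> cycle_edges [x, y, u, v] = {}"
    using no_shared unfolding no_triangle_shares_edge_with_C4_def by simp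
  then show False
    by (simp add: cycle_edges_3 cycle_edges_4)
qed

lemma arcs_V: "arcs V V = 2 * card E"
proof -
  have two: "card {(x, y). {x, y} = e} = 2" and fin: "finite {(x, y). {x, y} = e}" if e: "e \<in> E" for e
  proof -
    obtain x y where "e = {x, y}" "x \<noteq> y"
      using edgeE[OF e] by metis
    then have "{(x, y). {x, y} = e} = {(x, y), (y, x)}"
      by (auto simp: doubleton_eq_iff)
    then show "card {(x, y). {x, y} = e} = 2" "finite {(x, y). {x, y} = e}"
      using \<open>x \<noteq> y\<close> by auto
  qed
  have "Sigma V (nb V) = (\<Union>e\<in>E. {(x, y). {x, y} = e})"
    using edge by (auto simp: nb_def)
  then have "arcs V V = card (\<Union>e\<in>E. {(x, y). {x, y} = e})"
    using arcs_eq_card_Sigma[OF finite_V finite_V] by simp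
  also have "\<dots> = (\<Sum>e\<in>E. 2)"
    using finite_E two fin by (subst card_UN_disjoint) auto
  finally show ?thesis by simp
qed

text \<open>Closedness keeps everything reachable from \<open>x\<close> inside \<open>K\<close>;
  conversely the class of \<open>x\<close> is closed under neighbours and so contains
  \<open>K\<close> by \<open>dcomp_linked\<close>.\<close>

lemma dcomp_component:
  assumes "K \<in> tricomps V \<union> chaincomps V"
  shows "K \<in> components V E"
proof -
  obtain x where x: "x \<in> K"
    using dcomp_nonempty[OF assms] by blast
  note cl = dcomp_closed[OF assms]
  let ?C = "connected_rel V E `` {x}"
  have "?C \<subseteq> K"
  proof
    fix y assume "y \<in> ?C"
    then have "(x, y) \<in> {(x, y). {x, y} \<in> E}\<^sup>*"
      by (simp add: connected_rel_def)
    then show "y \<in> K"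
    proof (induction rule: rtrancl_induct)
      case base
      show ?case by (rule x)
    next
      case (step y z)
      then have "z \<in> nb V y"
        using edge by simp
      then show ?case
        using cl(2) step.IH by blast
    qed
  qed
  moreover have "K \<subseteq> ?C"
  proof (rule dcomp_linked[OF assms x])
    show "x \<in> ?C"
      using x cl(1) by (auto simp: connected_rel_def)
    show "\<forall>y\<in>?C. nb V y \<subseteq> ?C"
      by (auto simp: connected_rel_def intro: rtrancl_into_rtrancl)
  qed
  ultimately have "K = ?C" by (rule equalityI[rotated])
  moreover have "x \<in> V"
    using x cl(1) by blast
  ultimately show ?thesis
    unfolding components_def quotient_def by blast
qed

lemma induced_edge: "u \<in> K \<Longrightarrow> v \<in> K \<Longrightarrow> {u, v} \<in> induced_edges E K \<longleftrightarrow> {u, v} \<in> E"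
  by (simp add: induced_edges_def)

lemma tri_is_triangle:
  assumes "tri K"
  shows "is_triangle K (induced_edges E K)"
proof -
  obtain x y z where K: "K = {x, y, z}" "{x, y} \<in> E" "{y, z} \<in> E" "{x, z} \<in> E"
    using assms unfolding tri_def by blast
  have d: "x \<noteq> y" "y \<noteq> z" "x \<noteq> z" and s: "{y, x} \<in> E" "{z, y} \<in> E" "{z, x} \<in> E"
    "\<And>v. {v} \<notin> E"
    using K(2-4) edge by (auto simp: insert_commute) (metis insert_absorb2)
  define f :: "'a \<Rightarrow> nat" where "f v = (if v = x then 0 else if v = y then 1 else 2)" for v
  have f: "f x = 0" "f y = 1" "f z = 2"
    using d by (auto simp: f_def)
  have "bij_betw f K {0, 1, 2}"
    unfolding bij_betw_def inj_on_def K using f by auto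
  moreover have "\<forall>u\<in>K. \<forall>v\<in>K. {u, v} \<in> induced_edges E K \<longleftrightarrow> {f u, f v} \<in> {{0, 1}, {1, 2}, {0, 2}}"
    using K s f d by (auto simp: induced_edge doubleton_eq_iff)
  ultimately show ?thesis
    unfolding is_triangle_def graph_isomorphic_def by blast
qed

lemma chain_is_2_chain:
  assumes "chain K"
  shows "is_2_chain_of_triangles K (induced_edges E K)"
proof -
  obtain S T u v where c: "tri S" "tri T" "S \<inter> T = {}" "K = S \<union> T" "u \<in> S" "v \<in> T" "{u, v} \<in> E"
    and e: "\<And>a b. a \<in> S \<Longrightarrow> b \<in> T \<Longrightarrow> {a, b} \<in> E \<Longrightarrow> a = u \<and> b = v"
    using assms unfolding chain_def by metis
  obtain x y where S: "S = {u, x, y}" "{u, x} \<in> E" "{x, y} \<in> E" "{u, y} \<in> E" "u \<noteq> x" "x \<noteq> y" "u \<noteq> y"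
    using triE[OF c(1,5)] by metis
  obtain z w where T: "T = {v, z, w}" "{v, z} \<in> E" "{z, w} \<in> E" "{v, w} \<in> E" "v \<noteq> z" "z \<noteq> w" "v \<noteq> w"
    using triE[OF c(2,6)] by metis
  have K: "K = {x, y, u, v, z, w}"
    using c(4) S(1) T(1) by auto
  have d: "distinct [x, y, u, v, z, w]"
    using c(3) S T by auto
  have n: "{u, z} \<notin> E" "{u, w} \<notin> E" "{x, v} \<notin> E" "{x, z} \<notin> E" "{x, w} \<notin> E"
    "{y, v} \<notin> E" "{y, z} \<notin> E" "{y, w} \<notin> E"
    by (rule notI, drule e[rotated 2]; use d in \<open>simp add: S(1) T(1)\<close>)+
  have n': "{z, u} \<notin> E" "{w, u} \<notin> E" "{v, x} \<notin> E" "{z, x} \<notin> E" "{w, x} \<notin> E"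
    "{v, y} \<notin> E" "{z, y} \<notin> E" "{w, y} \<notin> E"
    using n by (simp_all add: insert_commute)
  have l: "{a} \<notin> E" for a
    using edge[of a a] by auto
  have s: "{v, u} \<in> E" "{x, u} \<in> E" "{y, x} \<in> E" "{y, u} \<in> E" "{z, v} \<in> E" "{w, z} \<in> E" "{w, v} \<in> E"
    using c(7) S T by (auto simp: insert_commute)
  \<comment> \<open>The order sends the bridge \<open>u v\<close> to \<open>{2, 3}\<close>.\<close>
  define f :: "'a \<Rightarrow> nat" where
    "f a = (if a = x then 0 else if a = y then 1 else if a = u then 2 else if a = v then 3
            else if a = z then 4 else 5)" for a
  have f: "f x = 0" "f y = 1" "f u = 2" "f v = 3" "f z = 4" "f w = 5"
    using d by (auto simp: f_def)
  have "bij_betw f K {0, 1, 2, 3, 4, 5}"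
    unfolding bij_betw_def inj_on_def K using f by simp
  moreover have "\<forall>a\<in>K. \<forall>b\<in>K. {a, b} \<in> induced_edges E K \<longleftrightarrow>
    {f a, f b} \<in> {{0, 1}, {1, 2}, {0, 2}} \<union> {{3, 4}, {4, 5}, {3, 5}} \<union> {{2, 3}}"
    unfolding induced_edges_def K by (simp add: f c(7) S(2-4) T(2-4) n n' l s doubleton_eq_iff)
  ultimately show ?thesis
    unfolding is_2_chain_of_triangles_def graph_isomorphic_def by blast
qed

text \<open>A component costs at most 2; the factor 3 lets difficult components be counted together
  with edges, which have coefficient 3.\<close>

lemma penalty_le: "penalty V \<le> 3 * num_difficult V E"
proof -
  let ?D = "{C \<in> components V E. difficult E C}"
  have "tricomps V \<union> chaincomps V \<subseteq> ?D"
    using dcomp_component tri_is_triangle chain_is_2_chain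
    unfolding difficult_def tricomps_def chaincomps_def by blast
  moreover have "finite ?D"
    using finite_V by (auto simp: components_def connected_rel_def intro!: finite_quotient)
  ultimately have "card (tricomps V \<union> chaincomps V) \<le> num_difficult V E"
    unfolding num_difficult_def by (rule card_mono[rotated])
  then show ?thesis
    using finite_dcomps[OF finite_V] tricomps_chaincomps_disjoint
    by (simp add: penalty_def card_Un_disjoint)
qed

lemma independence_number_ge:
  assumes "S \<subseteq> V" "indep S E"
  shows "card S \<le> independence_number V E"
  unfolding independence_number_def using assms finite_V by (intro Max_ge) auto

text \<open>Removing one end of every edge leaves an independent set. This is the case
  \<open>(a, b) = (0, 1)\<close>.\<close>

lemma independence_number_ge_card_diff: "card V \<le> independence_number V E + card E"
proof -
  define f where "f e = (SOME x. x \<in> e)" for e :: "'a set"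
  have f: "f e \<in> e" if "e \<in> E" for e
    using edgeE[OF that] unfolding f_def by (metis insertI1 someI)
  have "indep (V - f ` E) E"
    unfolding indep_def using f by (metis Diff_iff image_eqI insert_iff singletonD)
  then have "card (V - f ` E) \<le> independence_number V E"
    by (intro independence_number_ge) auto
  moreover have "card V - card (f ` E) \<le> card (V - f ` E)"
    using finite_E by (intro diff_card_le_card_Diff) simp
  moreover have "card (f ` E) \<le> card E"
    using finite_E by (rule card_image_le)
  ultimately show ?thesis by linarith
qed

lemma good_independence_number:
  assumes "good r q V"
  shows "r * card V \<le> q * independence_number V E + 3 * (card E + num_difficult V E)"
proof -
  obtain S where S: "S \<subseteq> V" "\<forall>x\<in>S. \<forall>y\<in>S. {x, y} \<notin> E"
    "2 * r * card V \<le> 2 * q * card S + 3 * arcs V V + 2 * penalty V"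
    using assms unfolding good_def by blast
  have "card S \<le> independence_number V E"
    using S(1,2) by (intro independence_number_ge) (auto simp: indep_def)
  then have "q * card S \<le> q * independence_number V E"
    by (rule mult_le_mono2)
  moreover have "2 * (r * card V) \<le> 2 * (q * card S) + 6 * card E + 2 * penalty V"
    using S(3) arcs_V by (simp add: mult.assoc)
  ultimately show ?thesis
    using penalty_le unfolding distrib_left by linarith
qed

end

text \<open>
  The vertices of the polyhedron of admissible \<open>(a, b)\<close> are \<open>(0, 1)\<close>, \<open>(5/13, 3/13)\<close>,
  \<open>(19/34, 3/34)\<close> and \<open>(1, 0)\<close>; its edges lie on the lines \<open>2a + b = 1\<close>, \<open>9a + 11b = 6\<close> and
  \<open>a + 5b = 1\<close>, and the remaining six conditions are implied by these three.
\<close>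

lemma convex_combination:
  fixes a b n m t :: real
  assumes "0 < a" "0 < b" "2 * a + b \<ge> 1" "9 * a + 11 * b \<ge> 6" "a + 5 * b \<ge> 1"
    and "0 \<le> n" "0 \<le> m" "t \<le> n" "t \<le> m" "13 * t \<le> 5 * n + 3 * m" "34 * t \<le> 19 * n + 3 * m"
  shows "t \<le> a * n + b * m"
proof -
  \<comment> \<open>The cuts are the first coordinates of the vertices. In the first three cases the
    two products are, up to scaling, the inequalities at the ends of the interval weighted by the
    position of \<open>a\<close>; the line through these ends bounds \<open>b\<close> from
    below.\<close>
  consider "a \<le> 5/13" | "5/13 \<le> a" "a \<le> 19/34" | "19/34 \<le> a" "a \<le> 1" | "1 \<le> a"
    by linarith
  then show ?thesis
  proof cases
    case 1
    have "0 \<le> a * (5 * n + 3 * m - 13 * t)" "0 \<le> (5 - 13 * a) * (m - t)"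
      using 1 assms by (auto intro!: mult_nonneg_nonneg)
    moreover have "(1 - 2 * a) * m \<le> b * m"
      using assms by (intro mult_right_mono) auto
    ultimately show ?thesis by (simp add: algebra_simps)
  next
    case 2
    have "0 \<le> (247 - 442 * a) * (5 * n + 3 * m - 13 * t)" "0 \<le> (442 * a - 170) * (19 * n + 3 * m - 34 * t)"
      using 2 assms by (auto intro!: mult_nonneg_nonneg)
    moreover have "(6 - 9 * a) * m \<le> 11 * b * m"
      using assms by (intro mult_right_mono) auto
    ultimately show ?thesis by (simp add: algebra_simps)
  next
    case 3
    have "0 \<le> (1 - a) * (19 * n + 3 * m - 34 * t)" "0 \<le> (34 * a - 19) * (n - t)"
      using 3 assms by (auto intro!: mult_nonneg_nonneg)
    moreover have "(1 - a) * m \<le> 5 * b * m"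
      using assms by (intro mult_right_mono) auto
    ultimately show ?thesis by (simp add: algebra_simps)
  next
    case 4
    have "1 * n \<le> a * n" "0 \<le> b * m"
      using 4 assms by (intro mult_right_mono mult_nonneg_nonneg; simp)+
    then show ?thesis using assms(8) by linarith
  qed
qed

theorem theorem1p5:
  fixes V :: "'a set" and E :: "'a set set" and a b :: real
  assumes "fin_simple_graph V E"
    and "no_triangle_shares_edge_with_C4 E"
    and "a > 0" and "b > 0"
    and "2 * a + b \<ge> 1"
    and "3 * a + 4 * b \<ge> 2"
    and "9 * a + 11 * b \<ge> 6"
    and "a + 5 * b \<ge> 1"
    and "4 * a + 9 * b \<ge> 3"
    and "10 * a + 16 * b \<ge> 7"
    and "13 * a + 20 * b \<ge> 8"
    and "5 * a + 14 * b \<ge> 4"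
    and "a + 3 / 2 * b \<ge> 2 / 3"
  shows "real (independence_number V E) \<ge>
    real (card V) - (a * real (card V) + b * real (card E) + b * real (num_difficult V E))"
proof -
  interpret sparse_graph V E
    using assms(1,2) by unfold_locales
  \<comment> \<open>Edges and difficult components share the coefficient \<open>b\<close>, so they
    are added into one quantity \<open>?m\<close>.\<close>
  let ?n = "real (card V)" and ?m = "real (card E + num_difficult V E)"
    and ?i = "real (independence_number V E)"
  have "real (8 * card V) \<le> real (13 * independence_number V E + 3 * (card E + num_difficult V E))"
    "real (15 * card V) \<le> real (34 * independence_number V E + 3 * (card E + num_difficult V E))"
    using good_independence_number good_13[OF finite_V] good_34[OF finite_V] by (intro of_nat_mono; blast)+
  moreover have "real (card V) \<le> real (independence_number V E + card E)"
    using independence_number_ge_card_diff by (intro of_nat_mono)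
  ultimately have "13 * (?n - ?i) \<le> 5 * ?n + 3 * ?m" "34 * (?n - ?i) \<le> 19 * ?n + 3 * ?m" "?n - ?i \<le> ?m"
    by simp_all
  then have "?n - ?i \<le> a * ?n + b * ?m"
    by (intro convex_combination[OF assms(3-5,7,8)]) simp_all
  then show ?thesis
    by (simp add: algebra_simps)
qed

end
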